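(* Suppose that $(x^{*},y^{*})\in X\times Y$ is a saddle-point of $f$, that for every $i\in\mathbf{N}$, $\|K\|\beta_i^2=\frac{1}{\tau_i}-\frac{1}{\tau_{i+1}}$ and $\|K\|(1-\alpha_{i-1})^2=\frac{1}{\sigma_i}-\frac{1}{\sigma_{i+1}}$, and that $\limsup_{i\to\infty}\tau_i<\infty$, $\limsup_{i\to\infty}\sigma_i<\infty$, $\|K\|\limsup_{i\to\infty}\tau_i<\frac12$, and $\|K\|\limsup_{i\to\infty}\sigma_i<\frac12$. Let $((x^k,y^k))_{k\in\mathbf{N}}$ be generated by the iterate scheme in the context, and let $\hat{x}_k=\frac{1}{k+1}\sum_{i=1}^{k+1}x^i$, $\hat{y}_k=\frac{1}{k+1}\sum_{i=1}^{k+1}y^i$. Then the following hold. (i) $((\hat{x}_k,\hat{y}_k))_{k\in\mathbf{N}}$ has at least one weakly sequential cluster point, and every weakly sequential cluster point of $((\hat{x}_k,\hat{y}_k))_{k\in\mathbf{N}}$ is a saddle-point of $f$. (ii) Suppose that $\mathcal{H}_1$ and $\mathcal{H}_2$ are finite-dimensional and that $\sup_{k\in\mathbf{N}}\alpha_k<+\infty$, $\sup_{k\in\mathbf{N}}\beta_k<+\infty$, $0<\inf_{k\in\mathbf{N}}\sigma_k\le\sup_{k\in\mathbf{N}}\sigma_k<\infty$, and $0<\inf_{k\in\mathbf{N}}\tau_k\le\sup_{k\in\mathbf{N}}\tau_k<\infty$. Then $((x^k,y^k))_{k\in\mathbf{N}}$ converges to a saddle-point of $f$.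
   Context: $\mathbf{N}$ is the set of nonnegative integers. $\mathcal{H}_1,\mathcal{H}_2$ are real Hilbert spaces; $\mathcal{H}_1\times\mathcal{H}_2$ is the Hilbert direct sum; $X\subseteq\mathcal{H}_1$ and $Y\subseteq\mathcal{H}_2$ are nonempty, closed and convex. $K:\mathcal{H}_1\to\mathcal{H}_2$ is a continuous linear operator with adjoint $K^{*}$ and operator norm $\|K\|$. $g:\mathcal{H}_1\to\mathbf{R}\cup\{+\infty\}$ and $h:\mathcal{H}_2\to\mathbf{R}\cup\{+\infty\}$ are proper, convex and lower semicontinuous, and $f(x,y)=\langle Kx,y\rangle+g(x)-h(y)$ for $(x,y)\in X\times Y$. Standing assumption: for every $y\in Y$, $f(\cdot,y)$ maps $X$ into $\mathbf{R}\cup\{+\infty\}$ and is proper; for every $x\in X$, $f(x,\cdot)$ maps $Y$ into $\mathbf{R}\cup\{-\infty\}$ and is proper (thus $g$ is finite on $X$, $h$ is finite on $Y$, and $f$ is real-valued on $X\times Y$). A saddle-point of $f$ is $(x^{*},y^{*})\in X\times Y$ with $f(x^{*},y)\le f(x^{*},y^{*})\le f(x,y^{*})$ for all $x\in X$, $y\in Y$. A weakly sequential cluster point of a sequence is the weak limit of some subsequence. Parameters: $(\tau_k)_{k\in\mathbf{N}},(\sigma_k)_{k\in\mathbf{N}}$ are sequences of positive reals and $(\alpha_k)_{k\in\mathbf{N}\cup\{-1\}},(\beta_k)_{k\in\mathbf{N}\cup\{-1\}}$ are sequences of nonnegative reals. Iterate scheme: for a nonempty closed convex set $C$ and a function $\varphi$,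 $\operatorname{Prox}^{C}_{\varphi}(v):=\operatorname{argmin}_{u\in C}\{\varphi(u)+\frac12\|u-v\|^2\}$. Given $(x^0,y^0)\in X\times Y$, set $\bar{x}^0=x^0$, $\bar{y}^0=y^0$, $x^{-1}=x^0$, $y^{-1}=y^0$, and for every $k\in\mathbf{N}$: $y^{k+1}=\operatorname{Prox}^{Y}_{\sigma_k h}(y^k+\sigma_kK\bar{x}^k)$; $\bar{y}^{k+1}=y^{k+1}+\beta_k(y^{k+1}-y^k)$; $x^{k+1}=\operatorname{Prox}^{X}_{\tau_k g}(x^k-\tau_kK^{*}\bar{y}^{k+1})$; $\bar{x}^{k+1}=x^{k+1}+\alpha_k(x^{k+1}-x^k)$. *)

theory Defs
  imports "HOL-Analysis.Analysis"
begin

text \<open>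
  Functions with values in \<open>\<real> \<union> {+\<infinity>}\<close> are functions into \<^typ>\<open>ereal\<close>.
  Real Hilbert spaces are types of sort \<open>{real_inner, complete_space}\<close>; their Hilbert direct
  sum is the library's product type with its componentwise inner product.
\<close>

definition proper_on :: "'a set \<Rightarrow> ('a \<Rightarrow> ereal) \<Rightarrow> bool" where
  "proper_on S \<phi> \<longleftrightarrow> (\<forall>x\<in>S. \<phi> x \<noteq> -\<infinity>) \<and> (\<exists>x\<in>S. \<phi> x \<noteq> \<infinity>)"

definition convex_ereal_fun :: "('a::real_vector \<Rightarrow> ereal) \<Rightarrow> bool" where
  "convex_ereal_fun \<phi> \<longleftrightarrow> convex {(x, r::real). \<phi> x \<le> ereal r}"

definition lsc_fun :: "('a::topological_space \<Rightarrow> ereal) \<Rightarrow> bool" where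
  "lsc_fun \<phi> \<longleftrightarrow> (\<forall>x. \<phi> x \<le> Liminf (at x) \<phi>)"

text \<open>
  The value at points with \<open>g x = h y = \<infinity>\<close> is an artefact of \<^typ>\<open>ereal\<close> arithmetic
  (\<open>\<infinity> - \<infinity> = \<infinity>\<close>). Such points do not occur in \<open>X \<times> Y\<close> under the standing
  properness assumption, which forces \<open>g\<close> and \<open>h\<close> to be finite on \<open>X\<close> and \<open>Y\<close>
  whatever this convention is.
\<close>
definition saddle_fun ::
  "('a::real_inner \<Rightarrow> 'b::real_inner) \<Rightarrow> ('a \<Rightarrow> ereal) \<Rightarrow> ('b \<Rightarrow> ereal) \<Rightarrow> 'a \<Rightarrow> 'b \<Rightarrow> ereal" where
  "saddle_fun K g h x y = ereal (K x \<bullet> y) + g x - h y"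

definition saddle_point :: "'a set \<Rightarrow> 'b set \<Rightarrow> ('a \<Rightarrow> 'b \<Rightarrow> ereal) \<Rightarrow> 'a \<times> 'b \<Rightarrow> bool" where
  "saddle_point X Y f p \<longleftrightarrow> p \<in> X \<times> Y \<and>
     (\<forall>x\<in>X. \<forall>y\<in>Y. f (fst p) y \<le> f (fst p) (snd p) \<and> f (fst p) (snd p) \<le> f x (snd p))"

definition prox :: "'a::real_inner set \<Rightarrow> ('a \<Rightarrow> ereal) \<Rightarrow> 'a \<Rightarrow> 'a" where
  "prox C \<phi> v = arg_min_on (\<lambda>u. \<phi> u + ereal (1/2 * (norm (u - v))\<^sup>2)) C"

definition weakly_tendsto :: "(nat \<Rightarrow> 'a::real_normed_vector) \<Rightarrow> 'a \<Rightarrow> bool" where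
  "weakly_tendsto u l \<longleftrightarrow> (\<forall>\<phi>::'a \<Rightarrow> real. bounded_linear \<phi> \<longrightarrow> (\<lambda>n. \<phi> (u n)) \<longlonglongrightarrow> \<phi> l)"

definition weak_seq_cluster_point :: "(nat \<Rightarrow> 'a::real_normed_vector) \<Rightarrow> 'a \<Rightarrow> bool" where
  "weak_seq_cluster_point u l \<longleftrightarrow> (\<exists>r::nat \<Rightarrow> nat. strict_mono r \<and> weakly_tendsto (u \<circ> r) l)"

end

theory Submission
  imports Defs "HOL-Complex_Analysis.Great_Picard"
begin

text \<open>
  The proof is a Lyapunov argument. Under the standing assumption \<open>g\<close> and \<open>h\<close> are finite on \<open>X\<close> and \<open>Y\<close>,
  so with the payoff \<open>F u v = K u \<bullet> v + g u - h v\<close> a point \<open>q\<close> of \<open>X \<times> Y\<close> is a saddle point iff the gap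
  \<open>F q\<^sub>1 p\<^sub>2 - F p\<^sub>1 q\<^sub>2\<close> is nonpositive for every \<open>p\<close> in \<open>X \<times> Y\<close>. Write \<open>L\<close> for the norm of \<open>K\<close> and
  \<open>d\<^sub>k = x\<^sub>k - x\<^sub>k\<^sub>-\<^sub>1\<close>. For every \<open>p = (u, v)\<close> the energy

  \<open>E\<^sub>k(p) = |x\<^sub>k - u|\<^sup>2 / (2 \<tau>\<^sub>k) + |y\<^sub>k - v|\<^sup>2 / (2 \<sigma>\<^sub>k) + K d\<^sub>k \<bullet> (y\<^sub>k - v) + L |d\<^sub>k|\<^sup>2\<close>

  satisfies \<open>gap p z\<^sub>k\<^sub>+\<^sub>1 + E\<^sub>k\<^sub>+\<^sub>1(p) + \<delta> |z\<^sub>k\<^sub>+\<^sub>1 - z\<^sub>k|\<^sup>2 \<le> E\<^sub>k(p)\<close> and \<open>E\<^sub>k(p) \<ge> \<delta> |z\<^sub>k - p|\<^sup>2\<close>, where \<open>z\<^sub>k = (x\<^sub>k, y\<^sub>k)\<close>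
  (lemmas \<open>energy_decrease\<close> and \<open>energy_lower_bound\<close>). The step-size rules are designed for this: the decrease
  of \<open>1 / \<tau>\<^sub>k\<close> and \<open>1 / \<sigma>\<^sub>k\<close> pays for the extrapolation terms with \<open>\<beta>\<^sub>k\<close> and \<open>1 - \<alpha>\<^sub>k\<^sub>-\<^sub>1\<close>, and the bounds by
  \<open>1/2\<close> leave a uniform margin \<open>\<delta> > 0\<close>.

  For the averages, summing the inequality and using convexity of the gap bounds the gap at the \<open>k\<close>-th
  average by \<open>E\<^sub>0(p) / (k + 1)\<close>. Taking for \<open>p\<close> the given saddle point shows that the iterates are bounded, so
  the averages have a weak cluster point; and since sublevel sets of the gap are closed and convex, hence
  weakly closed, the gap at every weak cluster point is nonpositive.

  In finite dimension the iterates have a cluster point. The weights converge and the steps tend to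
  \<open>0\<close>, so consecutive energies have the same limit along the subsequence and the inequality shows that
  the cluster point is a saddle point. The energy relative to it is monotone and tends to \<open>0\<close> along the
  subsequence, hence along the whole sequence.

  All Hilbert space facts used (proximal points, adjoints, projections, weak sequential compactness)
  come from one existence result for minimizers of a convex function plus \<open>1/2 |u - v|\<^sup>2\<close>, lemma
  \<open>proximal_minimizer_exists\<close>.
\<close>

section \<open>Convex functions with closed sublevel sets\<close>

text \<open>
  Lower semicontinuity of a finite function on \<open>S\<close>, phrased through sublevel sets. In this form it
  passes from strong to weak limits without change: a sublevel set of a convex function is convex,
  and a closed convex set is weakly closed.
\<close>
definition closed_sublevels :: "'a::topological_space set \<Rightarrow> ('a \<Rightarrow> real) \<Rightarrow> bool" where
  "closed_sublevels S \<phi> \<longleftrightarrow> (\<forall>c. closed {u\<in>S. \<phi> u \<le> c})"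

text \<open>
  \<open>\<phi> u + \<psi> u \<le> c\<close> fails exactly if some \<open>r\<close> separates \<open>c - \<psi> u\<close> from \<open>\<phi> u\<close>; so the sublevel set of
  the sum is an intersection of finite unions of closed sets.
\<close>
lemma closed_sublevels_add:
  assumes "closed_sublevels S \<phi>" "closed_sublevels S \<psi>"
  shows "closed_sublevels S (\<lambda>u. \<phi> u + \<psi> u)"
  unfolding closed_sublevels_def
proof
  fix c
  have "{u\<in>S. \<phi> u + \<psi> u \<le> c} = (\<Inter>r. {u\<in>S. \<phi> u \<le> r} \<union> {u\<in>S. \<psi> u \<le> c - r})"
    (is "?L = ?R")
  proof
    show "?R \<subseteq> ?L"
    proof
      fix u assume u: "u \<in> ?R"
      have "\<phi> u + \<psi> u \<le> c"
      proof (rule ccontr)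
        assume "\<not> ?thesis"
        then have "c - \<psi> u < \<phi> u" by simp
        then obtain r where "c - \<psi> u < r" "r < \<phi> u" using dense by blast
        moreover have "\<phi> u \<le> r \<or> \<psi> u \<le> c - r" using u by blast
        ultimately show False by linarith
      qed
      then show "u \<in> ?L" using u by blast
    qed
    show "?L \<subseteq> ?R" by force
  qed
  moreover have "closed ?R"
    using assms by (intro closed_INT ballI closed_Un) (auto simp: closed_sublevels_def)
  ultimately show "closed ?L" by simp
qed

lemma closed_sublevels_continuous:
  assumes "closed S" "continuous_on S \<phi>"
  shows "closed_sublevels S \<phi>"
  unfolding closed_sublevels_def
proof
  fix c
  have "{u\<in>S. \<phi> u \<le> c} = S \<inter> \<phi> -` {..c}" by auto
  then show "closed {u\<in>S. \<phi> u \<le> c}"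
    using continuous_closed_preimage[OF assms(2,1), of "{..c}"] by simp
qed

lemma closed_sublevels_fst:
  assumes "closed_sublevels X \<phi>" "closed Y"
  shows "closed_sublevels (X \<times> Y) (\<lambda>p. \<phi> (fst p))"
  unfolding closed_sublevels_def
proof
  fix c
  have "{p\<in>X \<times> Y. \<phi> (fst p) \<le> c} = {u\<in>X. \<phi> u \<le> c} \<times> Y" by auto
  then show "closed {p\<in>X \<times> Y. \<phi> (fst p) \<le> c}"
    using assms by (simp add: closed_sublevels_def closed_Times)
qed

lemma closed_sublevels_snd:
  assumes "closed X" "closed_sublevels Y \<psi>"
  shows "closed_sublevels (X \<times> Y) (\<lambda>p. \<psi> (snd p))"
  unfolding closed_sublevels_def
proof
  fix c
  have "{p\<in>X \<times> Y. \<psi> (snd p) \<le> c} = X \<times> {v\<in>Y. \<psi> v \<le> c}" by auto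
  then show "closed {p\<in>X \<times> Y. \<psi> (snd p) \<le> c}"
    using assms by (simp add: closed_sublevels_def closed_Times)
qed

lemma convex_on_fst:
  assumes "convex_on X \<phi>" "convex Y"
  shows "convex_on (X \<times> Y) (\<lambda>p. \<phi> (fst p))"
  using assms by (auto simp: convex_on_def convex_Times)

lemma convex_on_snd:
  assumes "convex X" "convex_on Y \<psi>"
  shows "convex_on (X \<times> Y) (\<lambda>p. \<psi> (snd p))"
  using assms by (auto simp: convex_on_def convex_Times)

lemma convex_on_affine:
  fixes \<phi> :: "'a::real_vector \<Rightarrow> real"
  assumes "linear \<phi>" "convex C"
  shows "convex_on C (\<lambda>u. \<phi> u + c)"
proof (rule convex_onI)
  fix t u w assume "(0::real) < t" "t < 1"
  show "\<phi> ((1 - t) *\<^sub>R u + t *\<^sub>R w) + c \<le> (1 - t) * (\<phi> u + c) + t * (\<phi> w + c)"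
    using assms(1) by (simp add: linear_add[OF assms(1)] linear_scale[OF assms(1)]) (simp add: algebra_simps)
qed fact

lemma convex_sublevel:
  assumes "convex_on S \<phi>"
  shows "convex {u\<in>S. \<phi> u \<le> c}"
proof (rule convexI)
  fix x y u v assume *: "x \<in> {u\<in>S. \<phi> u \<le> c}" "y \<in> {u\<in>S. \<phi> u \<le> c}" "0 \<le> u" "0 \<le> v" "u + v = (1::real)"
  have "\<phi> (u *\<^sub>R x + v *\<^sub>R y) \<le> u * \<phi> x + v * \<phi> y"
    using assms * by (auto simp: convex_on_def)
  also have "\<dots> \<le> u * c + v * c" using * by (intro add_mono mult_left_mono) auto
  also have "\<dots> = c" using * by (simp flip: distrib_right)
  finally show "u *\<^sub>R x + v *\<^sub>R y \<in> {u\<in>S. \<phi> u \<le> c}"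
    using assms * by (auto simp: convex_on_def convex_def)
qed

section \<open>Proximal points in Hilbert space\<close>

text \<open>
  Lower semicontinuity keeps \<open>\<psi>\<close> above \<open>\<psi> x0 - 1\<close> on a small ball, and convexity along the segment from
  \<open>x0\<close> to a far point turns this into a linear lower bound outside the ball.
\<close>
lemma convex_affine_growth_lower_bound:
  fixes \<psi> :: "'a::real_normed_vector \<Rightarrow> real"
  assumes cv: "convex_on C \<psi>" and lsc: "closed_sublevels C \<psi>" and x0: "x0 \<in> C"
  obtains r where "r > 0" "\<And>u. u \<in> C \<Longrightarrow> \<psi> x0 - 1 - norm (u - x0) / r \<le> \<psi> u"
proof -
  have "closed {u\<in>C. \<psi> u \<le> \<psi> x0 - 1}" using lsc by (simp add: closed_sublevels_def)
  then have "open (- {u\<in>C. \<psi> u \<le> \<psi> x0 - 1})" by (simp add: open_Compl)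
  moreover have "x0 \<in> - {u\<in>C. \<psi> u \<le> \<psi> x0 - 1}" by simp
  ultimately obtain e where e: "e > 0" "cball x0 e \<subseteq> - {u\<in>C. \<psi> u \<le> \<psi> x0 - 1}"
    by (meson open_contains_cball)
  then have near: "\<psi> x0 - 1 < \<psi> u" if "u \<in> C" "norm (u - x0) \<le> e" for u
    using that by (force simp: dist_norm norm_minus_commute)
  have "\<psi> x0 - 1 - norm (u - x0) / e \<le> \<psi> u" if u: "u \<in> C" for u
  proof (cases "norm (u - x0) \<le> e")
    case True
    have "0 \<le> norm (u - x0) / e" using e by simp
    then show ?thesis using near[OF u True] by linarith
  next
    case False
    define t where "t = e / norm (u - x0)"
    have n0: "norm (u - x0) > 0" using False e by linarith
    then have t: "0 < t" "t < 1" using False e by (auto simp: t_def)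
    define w where "w = (1 - t) *\<^sub>R x0 + t *\<^sub>R u"
    have "w - x0 = t *\<^sub>R (u - x0)" by (simp add: w_def algebra_simps)
    then have nw: "norm (w - x0) = e" using e(1) n0 by (simp add: t_def)
    have wC: "w \<in> C" using cv x0 u t by (auto simp: w_def convex_on_def convex_def)
    have "\<psi> x0 - 1 < \<psi> w" using near[OF wC] nw by simp
    also have "\<dots> \<le> (1 - t) * \<psi> x0 + t * \<psi> u"
      using convex_onD[OF cv, of t x0 u] t x0 u by (simp add: w_def)
    finally have "t * (\<psi> x0 - 1 / t) < t * \<psi> u" using t by (simp add: algebra_simps)
    then have "\<psi> x0 - 1 / t < \<psi> u" using t by simp
    then show ?thesis by (simp add: t_def)
  qed
  then show ?thesis using that e(1) by blast
qed

text \<open>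
  The quadratic term beats the linear lower bound, so the infimum is finite; it also makes the
  objective strongly convex, so the sublevel sets slightly above the infimum are nested closed sets
  whose diameters tend to \<open>0\<close>. Their common point is the minimizer. Existence of projections and the
  Riesz representation below are the cases \<open>\<psi> = 0\<close> and \<open>\<psi>\<close> linear.
\<close>
lemma proximal_minimizer_exists:
  fixes C :: "'a::{real_inner, complete_space} set"
  assumes ne: "C \<noteq> {}" and cl: "closed C"
    and cv: "convex_on C \<psi>" and lsc: "closed_sublevels C \<psi>"
  shows "\<exists>p\<in>C. \<forall>u\<in>C. \<psi> p + 1/2 * (norm (p - v))\<^sup>2 \<le> \<psi> u + 1/2 * (norm (u - v))\<^sup>2"
proof -
  define m where "m u = \<psi> u + 1/2 * (norm (u - v))\<^sup>2" for u
  obtain x0 where x0: "x0 \<in> C" using ne by blast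
  obtain r where r: "r > 0" and lb: "\<And>u. u \<in> C \<Longrightarrow> \<psi> x0 - 1 - norm (u - x0) / r \<le> \<psi> u"
    using convex_affine_growth_lower_bound[OF cv lsc x0] by blast
  have bdd: "bdd_below (m ` C)"
  proof (rule bdd_belowI2)
    fix u assume u: "u \<in> C"
    have "norm (u - x0) \<le> norm (u - v) + norm (v - x0)"
      using norm_triangle_ineq[of "u - v" "v - x0"] by simp
    then have "norm (u - x0) / r \<le> norm (u - v) / r + norm (v - x0) / r"
      using r by (simp add: divide_right_mono flip: add_divide_distrib)
    \<comment> \<open>the minimum over all \<open>t\<close> of \<open>t\<^sup>2 / 2 - t / r\<close> is \<open>- (1 / r)\<^sup>2 / 2\<close>\<close>
    moreover have "norm (u - v) / r \<le> 1/2 * (norm (u - v))\<^sup>2 + 1/2 * (1 / r)\<^sup>2"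
      using zero_le_power2[of "norm (u - v) - 1 / r"] by (simp add: power2_diff)
    ultimately show "\<psi> x0 - 1 - norm (v - x0) / r - 1/2 * (1 / r)\<^sup>2 \<le> m u"
      using lb[OF u] unfolding m_def by linarith
  qed
  define I where "I = Inf (m ` C)"
  have Ile: "I \<le> m u" if "u \<in> C" for u unfolding I_def using bdd that by (rule cINF_lower)
  define S where "S n = {u\<in>C. m u \<le> I + 1 / real (Suc n)}" for n
  have mlsc: "closed_sublevels C m" unfolding m_def
    by (intro closed_sublevels_add lsc closed_sublevels_continuous cl continuous_intros)
  have near: "(norm (u - w))\<^sup>2 \<le> 8 / real (Suc n)" if u: "u \<in> S n" and w: "w \<in> S n" for u w n
  proof -
    define z where "z = (1 - 1/2) *\<^sub>R u + (1/2) *\<^sub>R w"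
    have uw: "u \<in> C" "w \<in> C" using u w by (auto simp: S_def)
    have zC: "z \<in> C" unfolding z_def
      by (rule convexD) (use cv uw in \<open>auto simp: convex_on_def\<close>)
    have "\<psi> z \<le> (1 - 1/2) * \<psi> u + 1/2 * \<psi> w"
      unfolding z_def by (rule convex_onD[OF cv]) (use uw in auto)
    moreover have "(norm (z - v))\<^sup>2 = 1/2 * (norm (u - v))\<^sup>2 + 1/2 * (norm (w - v))\<^sup>2 - 1/4 * (norm (u - w))\<^sup>2"
    proof -
      have "z - v = (1/2) *\<^sub>R ((u - v) + (w - v))" by (simp add: z_def algebra_simps flip: scaleR_add_left)
      moreover have "u - w = (u - v) - (w - v)" by simp
      ultimately show ?thesis
        by (simp only: power2_norm_eq_inner inner_simps) (simp add: inner_commute field_simps)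
    qed
    \<comment> \<open>the midpoint cannot fall below the infimum, which forces \<open>u\<close> and \<open>w\<close> together\<close>
    ultimately have "m z \<le> 1/2 * m u + 1/2 * m w - 1/8 * (norm (u - w))\<^sup>2"
      unfolding m_def by (simp add: field_simps)
    then show ?thesis using Ile[OF zC] u w by (simp add: S_def)
  qed
  obtain p where p: "\<And>n. p \<in> S n"
  proof (rule decreasing_closed_nest[of S])
    show "closed (S n)" for n using mlsc by (simp add: S_def closed_sublevels_def)
    show "S n \<noteq> {}" for n
    proof -
      have "Inf (m ` C) < I + 1 / real (Suc n)" by (simp add: I_def)
      then obtain u where "u \<in> C" "m u < I + 1 / real (Suc n)"
        using ne bdd by (auto simp: cINF_less_iff)
      then show ?thesis by (auto simp: S_def intro: less_imp_le)
    qed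
    show "S n \<subseteq> S k" if "k \<le> n" for k n
    proof -
      have "1 / real (Suc n) \<le> 1 / real (Suc k)" using that by (simp add: frac_le)
      then show ?thesis by (auto simp: S_def)
    qed
    show "\<exists>n. \<forall>x\<in>S n. \<forall>y\<in>S n. dist x y < \<epsilon>" if "\<epsilon> > 0" for \<epsilon>
    proof -
      obtain n where n: "8 / \<epsilon>\<^sup>2 < real n" using reals_Archimedean2 by blast
      then have "8 < \<epsilon>\<^sup>2 * real (Suc n)" using that by (simp add: field_simps) (smt (verit) zero_less_power2)
      then have "8 / real (Suc n) < \<epsilon>\<^sup>2" by (simp add: field_simps)
      then have "(norm (x - y))\<^sup>2 < \<epsilon>\<^sup>2" if "x \<in> S n" "y \<in> S n" for x y
        using near[OF that] by linarith
      then have "dist x y < \<epsilon>" if "x \<in> S n" "y \<in> S n" for x y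
        using that \<open>\<epsilon> > 0\<close> unfolding dist_norm by (meson less_imp_le power2_less_imp_less)
      then show ?thesis by blast
    qed
  qed blast
  have "m p \<le> I"
  proof (rule field_le_epsilon)
    fix e :: real assume "e > 0"
    then obtain n where "1 / real (Suc n) < e" using nat_approx_posE by metis
    then show "m p \<le> I + e" using p[of n] by (simp add: S_def)
  qed
  then have "m p \<le> m u" if "u \<in> C" for u using Ile[OF that] by linarith
  moreover have "p \<in> C" using p[of 0] by (simp add: S_def)
  ultimately show ?thesis unfolding m_def by blast
qed

text \<open>
  First-order optimality: compare \<open>p\<close> with \<open>p + t (u - p)\<close>, divide by \<open>t\<close> and let \<open>t\<close> tend to \<open>0\<close>.
\<close>
lemma proximal_variational_inequality:
  fixes C :: "'a::real_inner set"
  assumes cv: "convex_on C \<psi>" and p: "p \<in> C"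
    and min: "\<And>u. u \<in> C \<Longrightarrow> \<psi> p + 1/2 * (norm (p - v))\<^sup>2 \<le> \<psi> u + 1/2 * (norm (u - v))\<^sup>2"
    and u: "u \<in> C"
  shows "\<psi> p - \<psi> u \<le> (v - p) \<bullet> (p - u)"
proof -
  have "\<psi> p - \<psi> u - (v - p) \<bullet> (p - u) \<le> t * (1/2 * (norm (u - p))\<^sup>2)" if t: "0 < t" "t < 1" for t
  proof -
    define w where "w = (1 - t) *\<^sub>R p + t *\<^sub>R u"
    have wC: "w \<in> C" using cv p u t by (auto simp: w_def convex_on_def convex_def)
    have "\<psi> w \<le> (1 - t) * \<psi> p + t * \<psi> u"
      unfolding w_def by (rule convex_onD[OF cv]) (use t p u in auto)
    moreover have "(norm (w - v))\<^sup>2 = (norm (p - v))\<^sup>2 + 2 * t * ((v - p) \<bullet> (p - u)) + t\<^sup>2 * (norm (u - p))\<^sup>2"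
    proof -
      have "w - v = (p - v) + t *\<^sub>R (u - p)" by (simp add: w_def algebra_simps)
      then show ?thesis
        by (simp only: power2_norm_eq_inner inner_simps inner_scaleR_left inner_scaleR_right) (simp add: inner_commute algebra_simps power2_eq_square)
    qed
    ultimately have "t * (\<psi> p - \<psi> u - (v - p) \<bullet> (p - u)) \<le> t * (t * (1/2 * (norm (u - p))\<^sup>2))"
      using min[OF wC] by (simp add: algebra_simps power2_eq_square)
    then show ?thesis using t by simp
  qed
  note * = this
  show ?thesis
  proof (rule ccontr)
    assume "\<not> ?thesis"
    then have "0 < \<psi> p - \<psi> u - (v - p) \<bullet> (p - u)" by simp
    moreover have "eventually (\<lambda>t. \<psi> p - \<psi> u - (v - p) \<bullet> (p - u) \<le> t * (1/2 * (norm (u - p))\<^sup>2)) (at_right (0::real))"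
      using * eventually_at_right_real[of 0 1] by (auto elim: eventually_mono)
    moreover have "((\<lambda>t::real. t * (1/2 * (norm (u - p))\<^sup>2)) \<longlongrightarrow> 0 * (1/2 * (norm (u - p))\<^sup>2)) (at_right 0)"
      by (intro tendsto_intros)
    ultimately show False
      using tendsto_lowerbound[of _ _ "at_right (0::real)"] by fastforce
  qed
qed

lemma arg_min_on_in_and_le:
  assumes "\<exists>p\<in>C. \<forall>u\<in>C. F p \<le> (F u :: 'c::linorder)"
  shows "arg_min_on F C \<in> C" "\<And>u. u \<in> C \<Longrightarrow> F (arg_min_on F C) \<le> F u"
proof -
  have "is_arg_min F (\<lambda>x. x \<in> C) (arg_min_on F C)"
    unfolding arg_min_on_def arg_min_def
    by (rule someI_ex) (use assms in \<open>force simp: is_arg_min_linorder\<close>)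
  then show "arg_min_on F C \<in> C" "\<And>u. u \<in> C \<Longrightarrow> F (arg_min_on F C) \<le> F u"
    by (auto simp: is_arg_min_linorder)
qed

text \<open>
  What the iteration needs to know of \<open>prox\<close>. The scaling by \<open>s\<close> is divided out, so that the
  inequality bounds a difference of values of \<open>\<psi>\<close> itself.
\<close>
lemma prox_in_and_variational_inequality:
  fixes C :: "'a::{real_inner, complete_space} set"
  assumes ne: "C \<noteq> {}" and cl: "closed C"
    and cv: "convex_on C \<psi>" and lsc: "closed_sublevels C \<psi>"
    and \<phi>: "\<forall>u\<in>C. \<phi> u = ereal (\<psi> u)" and s: "s > 0"
  shows "prox C (\<lambda>u. ereal s * \<phi> u) v \<in> C"
    and "u \<in> C \<Longrightarrow> \<psi> (prox C (\<lambda>u. ereal s * \<phi> u) v) - \<psi> u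
      \<le> ((1 / s) *\<^sub>R (v - prox C (\<lambda>u. ereal s * \<phi> u) v)) \<bullet> (prox C (\<lambda>u. ereal s * \<phi> u) v - u)"
proof -
  let ?F = "\<lambda>u. ereal s * \<phi> u + ereal (1/2 * (norm (u - v))\<^sup>2)"
  let ?p = "prox C (\<lambda>u. ereal s * \<phi> u) v"
  have p_def: "?p = arg_min_on ?F C" by (simp add: prox_def)
  have F: "?F u = ereal (s * \<psi> u + 1/2 * (norm (u - v))\<^sup>2)" if "u \<in> C" for u
    using \<phi> that by simp
  have cvs: "convex_on C (\<lambda>u. s * \<psi> u)" using cv s by (intro convex_on_cmul) auto
  have lscs: "closed_sublevels C (\<lambda>u. s * \<psi> u)"
    unfolding closed_sublevels_def
  proof
    fix c
    have "{u\<in>C. s * \<psi> u \<le> c} = {u\<in>C. \<psi> u \<le> c / s}" using s by (auto simp: field_simps)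
    then show "closed {u\<in>C. s * \<psi> u \<le> c}" using lsc by (simp add: closed_sublevels_def)
  qed
  have "\<exists>p\<in>C. \<forall>u\<in>C. ?F p \<le> ?F u"
    using proximal_minimizer_exists[OF ne cl cvs lscs, of v] F by auto
  note am = arg_min_on_in_and_le[OF this, folded p_def]
  show pC: "?p \<in> C" by (rule am(1))
  assume u: "u \<in> C"
  have "s * \<psi> ?p + 1/2 * (norm (?p - v))\<^sup>2 \<le> s * \<psi> w + 1/2 * (norm (w - v))\<^sup>2" if "w \<in> C" for w
    using am(2)[OF that] unfolding F[OF that] F[OF pC] by simp
  from proximal_variational_inequality[OF cvs pC this u]
  have "s * (\<psi> ?p - \<psi> u) \<le> (v - ?p) \<bullet> (?p - u)" by (simp add: algebra_simps)
  then show "\<psi> ?p - \<psi> u \<le> ((1 / s) *\<^sub>R (v - ?p)) \<bullet> (?p - u)"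
    using s by (simp only: inner_scaleR_left) (simp add: field_simps)
qed

lemma convex_ereal_fun_imp_convex_on:
  assumes \<phi>: "convex_ereal_fun \<phi>" and S: "convex S"
    and fin: "\<And>u. u \<in> S \<Longrightarrow> \<phi> u = ereal (\<psi> u)"
  shows "convex_on S \<psi>"
proof (rule convex_onI)
  fix t u w assume *: "0 < t" "t < (1::real)" "u \<in> S" "w \<in> S"
  have "(1 - t) *\<^sub>R u + t *\<^sub>R w \<in> S" using S * by (auto simp: convex_def)
  moreover have "(1 - t) *\<^sub>R (u, \<psi> u) + t *\<^sub>R (w, \<psi> w) \<in> {(x, r::real). \<phi> x \<le> ereal r}"
    using \<phi> * fin by (intro convexD) (auto simp: convex_ereal_fun_def)
  ultimately show "\<psi> ((1 - t) *\<^sub>R u + t *\<^sub>R w) \<le> (1 - t) * \<psi> u + t * \<psi> w"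
    using fin by simp
qed fact

lemma lsc_fun_imp_closed_sublevels:
  assumes \<phi>: "lsc_fun \<phi>" and S: "closed S"
    and fin: "\<And>u. u \<in> S \<Longrightarrow> \<phi> u = ereal (\<psi> u)"
  shows "closed_sublevels S \<psi>"
  unfolding closed_sublevels_def
proof
  fix c
  have "open {u. ereal c < \<phi> u}"
    unfolding open_subopen[of "{u. ereal c < \<phi> u}"]
  proof
    fix u assume u: "u \<in> {u. ereal c < \<phi> u}"
    then have "ereal c < Liminf (at u) \<phi>" using \<phi> unfolding lsc_fun_def by (auto intro: less_le_trans)
    then have "eventually (\<lambda>w. ereal c < \<phi> w) (at u)" by (rule less_LiminfD)
    then obtain T where "open T" "u \<in> T" "\<And>w. w \<in> T \<Longrightarrow> w \<noteq> u \<Longrightarrow> ereal c < \<phi> w"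
      unfolding eventually_at_topological by blast
    then show "\<exists>T. open T \<and> u \<in> T \<and> T \<subseteq> {u. ereal c < \<phi> u}" using u by blast
  qed
  then have "closed (S \<inter> - {u. ereal c < \<phi> u})" using S by (intro closed_Int) auto
  moreover have "S \<inter> - {u. ereal c < \<phi> u} = {u\<in>S. \<psi> u \<le> c}" using fin by auto
  ultimately show "closed {u\<in>S. \<psi> u \<le> c}" by simp
qed

section \<open>Riesz representation, projections and weak convergence\<close>

text \<open>
  The minimizer \<open>p\<close> of \<open>1/2 |u|\<^sup>2 - \<phi> u\<close> represents \<open>\<phi>\<close>: its variational inequality in the directions
  \<open>w\<close> and \<open>- w\<close> gives \<open>\<phi> w = w \<bullet> p\<close>.
\<close>
lemma riesz_representation:
  fixes \<phi> :: "'a::{real_inner, complete_space} \<Rightarrow> real"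
  assumes "bounded_linear \<phi>"
  obtains p where "\<And>u. \<phi> u = u \<bullet> p"
proof -
  interpret bounded_linear \<phi> by fact
  have minus: "\<phi> (- w) = - \<phi> w" for w using linear_neg[OF linear] .
  have lin: "linear (\<lambda>u. - \<phi> u)"
    by (intro linearI) (auto simp: add scaleR)
  have cv: "convex_on UNIV (\<lambda>u. - \<phi> u)" using convex_on_affine[OF lin, of UNIV 0] by simp
  have lsc: "closed_sublevels UNIV (\<lambda>u. - \<phi> u)"
    by (intro closed_sublevels_continuous continuous_intros linear_continuous_on) (auto intro: assms)
  obtain p where p: "\<And>u. - \<phi> p + 1/2 * (norm (p - 0))\<^sup>2 \<le> - \<phi> u + 1/2 * (norm (u - 0))\<^sup>2"
    using proximal_minimizer_exists[OF _ _ cv lsc, of 0] by auto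
  have *: "w \<bullet> p \<le> \<phi> w" for w
    using proximal_variational_inequality[OF cv, of p 0 "p + - w"] p
    by (simp add: add diff minus inner_commute)
  have "\<phi> w = w \<bullet> p" for w using *[of w] *[of "- w"] by (simp add: minus)
  then show ?thesis using that by blast
qed

text \<open>
  \<open>adjoint K\<close> is a choice among all maps with the defining identity; such a map exists by the Riesz
  representation of \<open>u \<mapsto> K u \<bullet> v\<close>.
\<close>
lemma inner_adjoint:
  fixes K :: "'a::{real_inner, complete_space} \<Rightarrow> 'b::real_inner"
  assumes "bounded_linear K"
  shows "K u \<bullet> v = u \<bullet> adjoint K v"
proof -
  have "\<exists>p. \<forall>u. K u \<bullet> v = u \<bullet> p" for v
    using riesz_representation[OF bounded_linear_compose[OF bounded_linear_inner_left assms]] by metis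
  then have "\<exists>f'. \<forall>u v. K u \<bullet> v = u \<bullet> f' v" by metis
  then show ?thesis unfolding adjoint_def by (rule someI2_ex) blast
qed

lemma projection_exists:
  fixes C :: "'a::{real_inner, complete_space} set"
  assumes "C \<noteq> {}" "closed C" "convex C"
  obtains p where "p \<in> C" "\<And>u. u \<in> C \<Longrightarrow> (v - p) \<bullet> (u - p) \<le> 0"
proof -
  have cv: "convex_on C (\<lambda>_. 0)" using assms(3) by (simp add: convex_on_def)
  have lsc: "closed_sublevels C (\<lambda>_. 0)" using assms(2) by (intro closed_sublevels_continuous continuous_intros)
  obtain p where p: "p \<in> C" "\<And>u. u \<in> C \<Longrightarrow> (norm (p - v))\<^sup>2 \<le> (norm (u - v))\<^sup>2"
    using proximal_minimizer_exists[OF assms(1,2) cv lsc, of v] by auto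
  have "(v - p) \<bullet> (u - p) \<le> 0" if "u \<in> C" for u
    using proximal_variational_inequality[OF cv p(1) _ that, of v] p(2) by (simp add: inner_diff_right)
  then show ?thesis using that p(1) by blast
qed

lemma weakly_tendsto_inner:
  fixes u :: "nat \<Rightarrow> 'a::real_inner"
  assumes "weakly_tendsto u l"
  shows "(\<lambda>n. u n \<bullet> v) \<longlonglongrightarrow> l \<bullet> v"
  using assms bounded_linear_inner_left[of v] unfolding weakly_tendsto_def by blast

lemma weakly_tendstoI:
  fixes u :: "nat \<Rightarrow> 'a::{real_inner, complete_space}"
  assumes "\<And>v. (\<lambda>n. u n \<bullet> v) \<longlonglongrightarrow> l \<bullet> v"
  shows "weakly_tendsto u l"
  unfolding weakly_tendsto_def
proof (intro allI impI)
  fix \<phi> :: "'a \<Rightarrow> real" assume "bounded_linear \<phi>"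
  then obtain p where "\<And>u. \<phi> u = u \<bullet> p" using riesz_representation by metis
  then show "(\<lambda>n. \<phi> (u n)) \<longlonglongrightarrow> \<phi> l" using assms by simp
qed

text \<open>
  If \<open>p\<close> is the projection of the weak limit \<open>l\<close>, then \<open>(l - p) \<bullet> (u n - p) \<le> 0\<close> passes to the limit and
  gives \<open>|l - p|\<^sup>2 \<le> 0\<close>.
\<close>
lemma closed_convex_weakly_sequentially_closed:
  fixes C :: "'a::{real_inner, complete_space} set"
  assumes C: "closed C" "convex C"
    and ev: "eventually (\<lambda>n. u n \<in> C) sequentially" and u: "weakly_tendsto u l"
  shows "l \<in> C"
proof -
  have "C \<noteq> {}" using ev eventually_happens[of _ sequentially] by fastforce
  then obtain p where p: "p \<in> C" "\<And>u. u \<in> C \<Longrightarrow> (l - p) \<bullet> (u - p) \<le> 0"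
    using projection_exists[OF _ C, of l] by blast
  have "(\<lambda>n. u n \<bullet> (l - p) - p \<bullet> (l - p)) \<longlonglongrightarrow> l \<bullet> (l - p) - p \<bullet> (l - p)"
    by (intro tendsto_intros weakly_tendsto_inner u)
  moreover have "eventually (\<lambda>n. u n \<bullet> (l - p) - p \<bullet> (l - p) \<le> 0) sequentially"
  proof (rule eventually_mono[OF ev])
    fix n assume "u n \<in> C"
    from p(2)[OF this] have "(u n - p) \<bullet> (l - p) \<le> 0" by (subst inner_commute)
    then show "u n \<bullet> (l - p) - p \<bullet> (l - p) \<le> 0" by (subst (asm) inner_diff_left)
  qed
  ultimately have "l \<bullet> (l - p) - p \<bullet> (l - p) \<le> 0"
    by (rule tendsto_upperbound) simp
  then have "(l - p) \<bullet> (l - p) \<le> 0" by (simp add: inner_diff_left)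
  then have "(l - p) \<bullet> (l - p) = 0" using inner_ge_zero[of "l - p"] by linarith
  then have "l = p" by (simp only: inner_eq_zero_iff right_minus_eq)
  then show ?thesis using p(1) by simp
qed

text \<open>
  A diagonal argument makes \<open>u (r n) \<bullet> u m\<close> converge in \<open>n\<close> for every \<open>m\<close>. The vectors \<open>v\<close> for which
  \<open>u (r n) \<bullet> v\<close> converges form a closed subspace \<open>T\<close> containing all \<open>u m\<close>. Vectors orthogonal to \<open>T\<close>
  pair to \<open>0\<close> with the sequence, so \<open>T\<close> is the whole space.
  The limit is a bounded linear functional of \<open>v\<close>, hence given by a vector.
\<close>
lemma bounded_imp_weakly_convergent_subsequence:
  fixes u :: "nat \<Rightarrow> 'a::{real_inner, complete_space}"
  assumes "bounded (range u)"
  obtains r l where "strict_mono (r :: nat \<Rightarrow> nat)" "weakly_tendsto (u \<circ> r) l"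
proof -
  obtain M where bdd: "\<And>n. norm (u n) \<le> M" using assms by (auto simp: bounded_iff)
  have M: "0 \<le> M" using bdd[of 0] norm_ge_zero order_trans by blast
  have prods: "norm (u n \<bullet> v) \<le> M * M" if "v \<in> range u" for n v
  proof -
    have "norm (u n \<bullet> v) \<le> norm (u n) * norm v" by (simp add: Cauchy_Schwarz_ineq2)
    also have "\<dots> \<le> M * M" using bdd that M by (intro mult_mono) auto
    finally show ?thesis .
  qed
  obtain r where r: "strict_mono r" "\<And>v. v \<in> range u \<Longrightarrow> \<exists>l. (\<lambda>n. u (r n) \<bullet> v) \<longlonglongrightarrow> l"
  proof (rule function_convergent_subsequence[of "range u" "\<lambda>n v. u n \<bullet> v" "M * M"])
    show "countable (range u)" by simp
  qed (use prods in auto)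
  define T where "T = {v. convergent (\<lambda>n. u (r n) \<bullet> v)}"
  have uT: "u m \<in> T" for m using r(2)[of "u m"] by (auto simp: T_def convergent_def)
  have sub: "subspace T"
  proof (rule subspaceI)
    show "0 \<in> T" by (simp add: T_def convergent_const)
    show "v + w \<in> T" if "v \<in> T" "w \<in> T" for v w
      using that convergent_add by (simp add: T_def inner_add_right)
    show "c *\<^sub>R v \<in> T" if "v \<in> T" for c v
      using that convergent_mult[OF convergent_const[of c]] by (simp add: T_def)
  qed
  have clT: "closed T"
    unfolding closed_sequential_limits
  proof (intro allI impI)
    fix w v assume wv: "(\<forall>n. w n \<in> T) \<and> w \<longlonglongrightarrow> v"
    have "Cauchy (\<lambda>n. u (r n) \<bullet> v)"
    proof (rule metric_CauchyI)
      fix e :: real assume e: "e > 0"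
      then have "e / (4 * (M + 1)) > 0" using M by simp
      with wv obtain j where j: "norm (w j - v) < e / (4 * (M + 1))"
        by (metis LIMSEQ_iff order_refl)
      have "Cauchy (\<lambda>n. u (r n) \<bullet> w j)" using wv by (auto simp: T_def convergent_Cauchy)
      then obtain N where N: "\<And>m n. m \<ge> N \<Longrightarrow> n \<ge> N \<Longrightarrow> dist (u (r m) \<bullet> w j) (u (r n) \<bullet> w j) < e / 2"
        using e unfolding Cauchy_def by (meson half_gt_zero)
      have small: "\<bar>u (r n) \<bullet> v - u (r n) \<bullet> w j\<bar> < e / 4" for n
      proof -
        have "\<bar>u (r n) \<bullet> v - u (r n) \<bullet> w j\<bar> \<le> norm (u (r n)) * norm (w j - v)"
          by (metis Cauchy_Schwarz_ineq2 inner_diff_right norm_minus_commute)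
        also have "\<dots> \<le> M * norm (w j - v)" using bdd by (intro mult_right_mono) auto
        also have "\<dots> \<le> (M + 1) * norm (w j - v)" by (intro mult_right_mono) auto
        also have "\<dots> < (M + 1) * (e / (4 * (M + 1)))" using j M by (intro mult_strict_left_mono) auto
        also have "\<dots> = e / 4" using M by (simp add: field_simps)
        finally show ?thesis .
      qed
      show "\<exists>N. \<forall>m\<ge>N. \<forall>n\<ge>N. dist (u (r m) \<bullet> v) (u (r n) \<bullet> v) < e"
      proof (intro exI allI impI)
        fix m n assume "m \<ge> N" "n \<ge> N"
        then show "dist (u (r m) \<bullet> v) (u (r n) \<bullet> v) < e"
          using N[of m n] small[of m] small[of n] unfolding dist_real_def by linarith
      qed
    qed
    then show "v \<in> T" by (simp add: T_def Cauchy_convergent)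
  qed
  have all: "v \<in> T" for v
  proof -
    obtain p where p: "p \<in> T" "\<And>w. w \<in> T \<Longrightarrow> (v - p) \<bullet> (w - p) \<le> 0"
      using projection_exists[of T v] sub clT subspace_imp_convex subspace_0 by blast
    have "(v - p) \<bullet> w \<le> 0" if "w \<in> T" for w
      using p(2)[of "p + w"] subspace_add[OF sub p(1) that] by simp
    then have "(v - p) \<bullet> w = 0" if "w \<in> T" for w
      using that subspace_neg[OF sub that] by (metis inner_minus_right neg_le_0_iff_le order_antisym)
    then have "u (r n) \<bullet> v = u (r n) \<bullet> p" for n
      using uT[of "r n"] by (simp add: inner_diff_left inner_commute[of "u (r n)"])
    then show ?thesis using p(1) by (simp add: T_def)
  qed
  define \<phi> where "\<phi> v = lim (\<lambda>n. u (r n) \<bullet> v)" for v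
  have lim: "(\<lambda>n. u (r n) \<bullet> v) \<longlonglongrightarrow> \<phi> v" for v
    using all[of v] by (simp add: T_def \<phi>_def convergent_LIMSEQ_iff)
  have "bounded_linear \<phi>"
  proof (rule bounded_linear_intro[where K = M])
    show "\<phi> (v + w) = \<phi> v + \<phi> w" for v w
      using tendsto_add[OF lim[of v] lim[of w]] lim[of "v + w"]
      by (auto simp: inner_add_right intro: LIMSEQ_unique)
    show "\<phi> (c *\<^sub>R v) = c *\<^sub>R \<phi> v" for c v
      using tendsto_mult_left[OF lim[of v], of c] lim[of "c *\<^sub>R v"]
      by (auto intro: LIMSEQ_unique)
    have "\<bar>u n \<bullet> v\<bar> \<le> norm v * M" for n v
      using Cauchy_Schwarz_ineq2[of "u n" v] mult_right_mono[OF bdd[of n], of "norm v"]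
      by (simp add: mult.commute)
    then show "norm (\<phi> v) \<le> norm v * M" for v
      using tendsto_upperbound[OF tendsto_rabs[OF lim[of v]], of "norm v * M"] by simp
  qed
  then obtain l where "\<And>v. \<phi> v = v \<bullet> l" using riesz_representation by metis
  then have "weakly_tendsto (u \<circ> r) l"
    using lim by (intro weakly_tendstoI) (simp add: inner_commute)
  then show ?thesis using that r(1) by blast
qed

text \<open>
  Expand in a finite orthogonal basis; weak convergence is convergence of the coefficients.
\<close>
lemma finite_dimensional_weakly_tendsto_imp_tendsto:
  fixes u :: "nat \<Rightarrow> 'a::real_inner"
  assumes fd: "\<exists>B::'a set. finite_dimensional_vector_space scaleR B"
    and u: "weakly_tendsto u l"
  shows "u \<longlonglongrightarrow> l"
proof -
  obtain B :: "'a set" where "finite_dimensional_vector_space scaleR B" using fd by blast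
  then have "finite B" "module.span scaleR B = UNIV"
    by (auto simp: finite_dimensional_vector_space_def finite_dimensional_vector_space_axioms_def)
  then obtain C :: "'a set" where C: "finite C" "span C = UNIV" "pairwise orthogonal C"
    using basis_orthogonal[of B] by (auto simp: span_raw_def)
  have expand: "w = (\<Sum>b\<in>C. (w \<bullet> b / (b \<bullet> b)) *\<^sub>R b)" for w
  proof -
    let ?d = "w - (\<Sum>b\<in>C. (w \<bullet> b / (b \<bullet> b)) *\<^sub>R b)"
    have "orthogonal ?d c" if c: "c \<in> C" for c
    proof -
      have "(\<Sum>b\<in>C. (w \<bullet> b / (b \<bullet> b)) *\<^sub>R b) \<bullet> c = (\<Sum>b\<in>C. if b = c then w \<bullet> c else 0)"
        unfolding inner_sum_left
        by (rule sum.cong) (use C(3) c in \<open>auto simp: pairwise_def orthogonal_def\<close>)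
      also have "\<dots> = w \<bullet> c" using C(1) c by simp
      finally show ?thesis by (simp add: orthogonal_def inner_diff_left)
    qed
    then have "orthogonal ?d ?d"
      using C(2) by (intro orthogonal_to_span[of ?d C]) auto
    then show ?thesis by (simp add: orthogonal_self)
  qed
  have "(\<lambda>n. \<Sum>b\<in>C. (u n \<bullet> b / (b \<bullet> b)) *\<^sub>R b) \<longlonglongrightarrow> (\<Sum>b\<in>C. (l \<bullet> b / (b \<bullet> b)) *\<^sub>R b)"
    by (intro tendsto_sum tendsto_scaleR tendsto_const)
      (simp add: divide_inverse tendsto_mult_right weakly_tendsto_inner[OF u])
  then show ?thesis by (simp flip: expand)
qed

section \<open>The saddle gap\<close>

text \<open>
  With the payoff \<open>F u v = K u \<bullet> v + g u - h v\<close> this is \<open>F q\<^sub>1 p\<^sub>2 - F p\<^sub>1 q\<^sub>2\<close>. A point \<open>q\<close> is a saddle point iff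
  the gap is nonpositive for every \<open>p\<close>.
\<close>
definition saddle_gap ::
  "('a::real_inner \<Rightarrow> 'b::real_inner) \<Rightarrow> ('a \<Rightarrow> real) \<Rightarrow> ('b \<Rightarrow> real) \<Rightarrow> 'a \<times> 'b \<Rightarrow> 'a \<times> 'b \<Rightarrow> real" where
  "saddle_gap K g h p q =
     (K (fst q) \<bullet> snd p + g (fst q) - h (snd p)) - (K (fst p) \<bullet> snd q + g (fst p) - h (snd q))"

lemma saddle_gap_antisym: "saddle_gap K g h p q = - saddle_gap K g h q p"
  by (simp add: saddle_gap_def)

text \<open>
  As a function of \<open>q\<close> the bilinear payoff leaves only affine coupling terms, which is why the gap is
  convex and lower semicontinuous in \<open>q\<close>.
\<close>
lemma saddle_gap_eq_separable:
  "saddle_gap K g h p = (\<lambda>q. (g (fst q) + h (snd q))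
     + (K (fst q) \<bullet> snd p - K (fst p) \<bullet> snd q + (- h (snd p) - g (fst p))))"
  by (rule ext) (simp add: saddle_gap_def)

lemma convex_on_saddle_gap:
  assumes "bounded_linear K" "convex_on X g" "convex_on Y h"
  shows "convex_on (X \<times> Y) (saddle_gap K g h p)"
proof -
  have cvx: "convex X" "convex Y" using assms by (auto simp: convex_on_def)
  have "linear (\<lambda>q. K (fst q) \<bullet> snd p - K (fst p) \<bullet> snd q)"
    using bounded_linear.linear[OF assms(1)]
    by (intro linearI) (simp_all add: linear_add linear_scale inner_simps algebra_simps)
  then show ?thesis
    unfolding saddle_gap_eq_separable
    by (intro convex_on_add[OF convex_on_add] convex_on_affine convex_on_fst convex_on_snd)
      (use assms cvx in \<open>auto intro: convex_Times\<close>)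
qed

lemma closed_sublevels_saddle_gap:
  assumes K: "bounded_linear K" and X: "closed X" "closed_sublevels X g"
    and Y: "closed Y" "closed_sublevels Y h"
  shows "closed_sublevels (X \<times> Y) (saddle_gap K g h p)"
proof -
  have "continuous_on (X \<times> Y) (\<lambda>q. K (fst q) \<bullet> snd p - K (fst p) \<bullet> snd q + (- h (snd p) - g (fst p)))"
    by (intro continuous_intros bounded_linear.continuous_on[OF K])
  then have "closed_sublevels (X \<times> Y) (\<lambda>q. K (fst q) \<bullet> snd p - K (fst p) \<bullet> snd q + (- h (snd p) - g (fst p)))"
    using X Y by (intro closed_sublevels_continuous closed_Times)
  then show ?thesis
    unfolding saddle_gap_eq_separable
    using X Y by (intro closed_sublevels_add[OF closed_sublevels_add] closed_sublevels_fst closed_sublevels_snd)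
qed

section \<open>Energy estimates for the primal-dual iteration\<close>

lemma nonneg_decseq_convergent:
  fixes f :: "nat \<Rightarrow> real"
  assumes "decseq f" "\<And>n. 0 \<le> f n"
  shows "convergent f"
  by (rule decseq_convergent[OF assms(1), of 0]) (use assms(2) in \<open>auto simp: convergent_def\<close>)

lemma tendsto_zero_if_norm_square_le:
  fixes u :: "nat \<Rightarrow> 'a::real_normed_vector"
  assumes c: "0 < (c::real)" and le: "\<And>n. c * (norm (u n))\<^sup>2 \<le> f n" and f: "f \<longlonglongrightarrow> 0"
  shows "u \<longlonglongrightarrow> 0"
proof -
  have lim: "(\<lambda>n. f n / c) \<longlonglongrightarrow> 0 / c" using c by (intro tendsto_intros f) auto
  have "(\<lambda>n. (norm (u n))\<^sup>2) \<longlonglongrightarrow> 0"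
  proof (rule tendsto_sandwich[OF _ _ tendsto_const])
    show "eventually (\<lambda>n. (norm (u n))\<^sup>2 \<le> f n / c) sequentially"
      using le c by (intro always_eventually allI) (simp add: pos_le_divide_eq mult.commute)
    show "(\<lambda>n. f n / c) \<longlonglongrightarrow> 0" using lim by simp
  qed auto
  then have "(\<lambda>n. sqrt ((norm (u n))\<^sup>2)) \<longlonglongrightarrow> sqrt 0" by (rule tendsto_real_sqrt)
  then show ?thesis by (simp add: tendsto_norm_zero_iff)
qed

text \<open>
  The iteration with each proximal step replaced by its variational inequality. Here \<open>a\<close> and \<open>b\<close> are
  the reciprocals of the primal and dual step sizes, and \<open>\<rho> k = 1 - \<alpha>\<^sub>k\<^sub>-\<^sub>1\<close> measures how far the
  extrapolation is from the classical choice \<open>\<alpha> = 1\<close>. At \<open>k = 0\<close> the truncated index \<open>k - 1\<close> gives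
  \<open>x k - x (k - 1) = 0\<close>, in accordance with the convention \<open>x\<^sup>-\<^sup>1 = x\<^sup>0\<close>.
\<close>
locale primal_dual_iteration =
  fixes X :: "'a::{real_inner, complete_space} set" and Y :: "'b::{real_inner, complete_space} set"
    and K :: "'a \<Rightarrow> 'b" and g :: "'a \<Rightarrow> real" and h :: "'b \<Rightarrow> real"
    and L \<delta> :: real and a b \<beta> \<rho> :: "nat \<Rightarrow> real" and x :: "nat \<Rightarrow> 'a" and y :: "nat \<Rightarrow> 'b"
  assumes K: "bounded_linear K"
    and L: "0 \<le> L" "\<And>u v. K u \<bullet> v \<le> L * (norm u * norm v)"
    and X: "closed X" "convex_on X g" "closed_sublevels X g"
    and Y: "closed Y" "convex_on Y h" "closed_sublevels Y h"
    and x_in: "\<And>k. x k \<in> X" and y_in: "\<And>k. y k \<in> Y"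
    and y_step: "\<And>k v. v \<in> Y \<Longrightarrow> h (y (Suc k)) - h v
      \<le> (b k *\<^sub>R (y k - y (Suc k)) + K (x k + (1 - \<rho> k) *\<^sub>R (x k - x (k - 1)))) \<bullet> (y (Suc k) - v)"
    and x_step: "\<And>k u. u \<in> X \<Longrightarrow> g (x (Suc k)) - g u
      \<le> a k * ((x k - x (Suc k)) \<bullet> (x (Suc k) - u))
        - K (x (Suc k) - u) \<bullet> (y (Suc k) + \<beta> k *\<^sub>R (y (Suc k) - y k))"
    and a_step: "\<And>k. L * (\<beta> k)\<^sup>2 = a k - a (Suc k)"
    and b_step: "\<And>k. L * (\<rho> k)\<^sup>2 = b k - b (Suc k)"
    and \<delta>: "0 < \<delta>" "\<And>k. L + \<delta> \<le> a k / 2" "\<And>k. L + \<delta> \<le> b k / 2"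
begin

abbreviation gap :: "'a \<times> 'b \<Rightarrow> 'a \<times> 'b \<Rightarrow> real" where
  "gap \<equiv> saddle_gap K g h"

abbreviation z :: "nat \<Rightarrow> 'a \<times> 'b" where
  "z k \<equiv> (x k, y k)"

text \<open>
  A weighted squared distance to \<open>p\<close>, corrected by the coupling term that telescopes and by a multiple
  of the last primal step that pays for the Young inequalities.
\<close>
definition energy :: "nat \<Rightarrow> 'a \<times> 'b \<Rightarrow> real" where
  "energy k p = a k / 2 * (norm (x k - fst p))\<^sup>2 + b k / 2 * (norm (y k - snd p))\<^sup>2
     + K (x k - x (k - 1)) \<bullet> (y k - snd p) + L * (norm (x k - x (k - 1)))\<^sup>2"

lemma bilinear_Young: "K u \<bullet> v \<le> L / 2 * (norm u)\<^sup>2 + L / 2 * (norm v)\<^sup>2"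
proof -
  have "norm u * norm v \<le> 1/2 * (norm u)\<^sup>2 + 1/2 * (norm v)\<^sup>2"
    using zero_le_power2[of "norm u - norm v"] by (simp add: power2_diff)
  then have "L * (norm u * norm v) \<le> L * (1/2 * (norm u)\<^sup>2 + 1/2 * (norm v)\<^sup>2)"
    using L(1) by (rule mult_left_mono)
  then show ?thesis using L(2)[of u v] by (simp add: algebra_simps)
qed

text \<open>
  Add the two variational inequalities at \<open>p\<close>. The bilinear terms collapse to a telescoping difference
  of coupling terms plus three products, one each with factor \<open>\<beta> k\<close>, \<open>\<rho> k\<close> and \<open>1\<close>. By Young the first two
  cost \<open>L (\<beta> k)\<^sup>2 / 2\<close> and \<open>L (\<rho> k)\<^sup>2 / 2\<close> times a squared distance to \<open>p\<close>, which is exactly what the change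
  of the weights \<open>a\<close> and \<open>b\<close> provides; the squared steps that remain have total factor \<open>L\<close> and are
  absorbed because \<open>a / 2\<close> and \<open>b / 2\<close> exceed \<open>L\<close> by at least \<open>\<delta>\<close>.
\<close>
lemma energy_decrease:
  assumes p: "p \<in> X \<times> Y"
  shows "gap p (z (Suc k)) + energy (Suc k) p + \<delta> * (norm (z (Suc k) - z k))\<^sup>2 \<le> energy k p"
proof -
  interpret K: bounded_linear K by (rule K)
  obtain u v where uv: "p = (u, v)" "u \<in> X" "v \<in> Y" using p by auto
  define d where "d = x k - x (k - 1)"
  define d' where "d' = x (Suc k) - x k"
  define e where "e = y (Suc k) - y k"
  define s where "s = x (Suc k) - u"
  define w where "w = y k - v"
  define t where "t = y (Suc k) - v"
  have gap_eq: "gap p (z (Suc k)) = K (x (Suc k)) \<bullet> v - K u \<bullet> y (Suc k)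
      + (g (x (Suc k)) - g u) + (h (y (Suc k)) - h v)"
    by (simp add: saddle_gap_def uv)
  have gx: "g (x (Suc k)) - g u \<le> - (a k * (d' \<bullet> s)) - K s \<bullet> y (Suc k) - \<beta> k * (K s \<bullet> e)"
    using x_step[OF uv(2), of k]
    by (simp add: s_def d'_def e_def inner_add_right inner_diff_left algebra_simps)
  have hy: "h (y (Suc k)) - h v \<le> - (b k * (e \<bullet> t)) + K (x k) \<bullet> t + K d \<bullet> t - \<rho> k * (K d \<bullet> t)"
  proof -
    have "y k - y (Suc k) = - e" by (simp add: e_def)
    then show ?thesis
      using y_step[OF uv(3), of k] unfolding d_def[symmetric] t_def[symmetric]
      by (simp add: K.add K.scaleR inner_add_left inner_diff_left left_diff_distrib)
  qed
  \<comment> \<open>the coupling terms without extrapolation factor; with the summand \<open>K d \<bullet> t\<close> of the dual step,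
    which is \<open>K d \<bullet> w\<close> up to \<open>K d \<bullet> e\<close>, they telescope\<close>
  have bil: "K (x (Suc k)) \<bullet> v - K u \<bullet> y (Suc k) - K s \<bullet> y (Suc k) + K (x k) \<bullet> t = - (K d' \<bullet> t)"
    by (simp add: s_def t_def d'_def K.diff inner_diff_left inner_diff_right)
  have xp: "(norm (x k - u))\<^sup>2 = (norm s)\<^sup>2 - 2 * (d' \<bullet> s) + (norm d')\<^sup>2"
  proof -
    have "x k - u = s - d'" by (simp add: s_def d'_def)
    then show ?thesis by (simp add: power2_norm_eq_inner inner_diff_left inner_diff_right inner_commute)
  qed
  have yp: "(norm w)\<^sup>2 = (norm t)\<^sup>2 - 2 * (e \<bullet> t) + (norm e)\<^sup>2"
  proof -
    have "w = t - e" by (simp add: t_def e_def w_def)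
    then show ?thesis by (simp add: power2_norm_eq_inner inner_diff_left inner_diff_right inner_commute)
  qed
  have Kdt: "K d \<bullet> t \<le> K d \<bullet> w + K d \<bullet> e"
    by (simp add: t_def e_def w_def flip: inner_add_right)
  have y1: "- (\<beta> k * (K s \<bullet> e)) \<le> 1/2 * ((a k - a (Suc k)) * (norm s)\<^sup>2) + L / 2 * (norm e)\<^sup>2"
    using bilinear_Young[of "(- \<beta> k) *\<^sub>R s" e]
    by (simp add: linear_neg[OF K.linear] K.scaleR power_mult_distrib flip: a_step)
  have y2: "- (\<rho> k * (K d \<bullet> t)) \<le> L / 2 * (norm d)\<^sup>2 + 1/2 * ((b k - b (Suc k)) * (norm t)\<^sup>2)"
    using bilinear_Young[of d "(- \<rho> k) *\<^sub>R t"]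
    by (simp add: power_mult_distrib flip: b_step)
  have y3: "K d \<bullet> e \<le> L / 2 * (norm d)\<^sup>2 + L / 2 * (norm e)\<^sup>2" by (rule bilinear_Young)
  have d1: "(L + \<delta>) * (norm d')\<^sup>2 \<le> a k / 2 * (norm d')\<^sup>2"
    using \<delta>(2) by (intro mult_right_mono) auto
  have d2: "(L + \<delta>) * (norm e)\<^sup>2 \<le> b k / 2 * (norm e)\<^sup>2"
    using \<delta>(3) by (intro mult_right_mono) auto
  have nz: "(norm (z (Suc k) - z k))\<^sup>2 = (norm d')\<^sup>2 + (norm e)\<^sup>2"
    by (simp add: norm_Pair d'_def e_def)
  have Ek: "energy k p = a k / 2 * (norm (x k - u))\<^sup>2 + b k / 2 * (norm w)\<^sup>2
      + K d \<bullet> w + L * (norm d)\<^sup>2"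
    by (simp add: energy_def uv d_def w_def)
  have Ek': "energy (Suc k) p = a (Suc k) / 2 * (norm s)\<^sup>2 + b (Suc k) / 2 * (norm t)\<^sup>2
      + K d' \<bullet> t + L * (norm d')\<^sup>2"
    by (simp add: energy_def uv d'_def s_def t_def)
  show ?thesis
    using gx hy eq_refl[OF bil] Kdt y1 y2 y3 d1 d2
    unfolding gap_eq nz Ek Ek' xp yp by (simp add: algebra_simps)
qed

lemma energy_lower_bound: "\<delta> * (norm (z k - p))\<^sup>2 \<le> energy k p"
proof -
  interpret K: bounded_linear K by (rule K)
  define d where "d = x k - x (k - 1)"
  have "- (K d \<bullet> (y k - snd p)) \<le> L / 2 * (norm d)\<^sup>2 + L / 2 * (norm (y k - snd p))\<^sup>2"
    using bilinear_Young[of "- d" "y k - snd p"] by (simp add: linear_neg[OF K.linear])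
  moreover have "(L + \<delta>) * (norm (x k - fst p))\<^sup>2 \<le> a k / 2 * (norm (x k - fst p))\<^sup>2"
    "(L + \<delta>) * (norm (y k - snd p))\<^sup>2 \<le> b k / 2 * (norm (y k - snd p))\<^sup>2"
    using \<delta>(2,3) by (intro mult_right_mono; simp)+
  moreover have "0 \<le> L * (norm (x k - fst p))\<^sup>2" "0 \<le> L * (norm (y k - snd p))\<^sup>2" "0 \<le> L * (norm d)\<^sup>2"
    using L(1) by auto
  moreover have "(norm (z k - p))\<^sup>2 = (norm (x k - fst p))\<^sup>2 + (norm (y k - snd p))\<^sup>2"
    by (cases p) (simp add: norm_Pair)
  ultimately show ?thesis
    unfolding energy_def d_def[symmetric] by (simp add: algebra_simps)
qed

lemma energy_nonneg: "0 \<le> energy k p"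
  using energy_lower_bound[of k p] \<delta>(1) by (smt (verit) mult_nonneg_nonneg zero_le_power2)

lemma z_in: "z k \<in> X \<times> Y"
  using x_in y_in by simp

lemma convex_gap: "convex_on (X \<times> Y) (gap p)"
  using K X Y by (intro convex_on_saddle_gap)

lemma closed_sublevels_gap: "closed_sublevels (X \<times> Y) (gap p)"
  using K X Y by (intro closed_sublevels_saddle_gap)

definition is_saddle :: "'a \<times> 'b \<Rightarrow> bool" where
  "is_saddle q \<longleftrightarrow> q \<in> X \<times> Y \<and> (\<forall>p\<in>X \<times> Y. gap p q \<le> 0)"

definition ergodic :: "nat \<Rightarrow> 'a \<times> 'b" where
  "ergodic k = (1 / (real k + 1)) *\<^sub>R (\<Sum>i=1..k+1. z i)"

lemma ergodic_eq_sum: "ergodic k = (\<Sum>i=1..k+1. (1 / (real k + 1)) *\<^sub>R z i)"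
  unfolding ergodic_def by (rule scaleR_sum_right)

lemma ergodic_in_convex:
  assumes "convex C" "\<And>k. z k \<in> C"
  shows "ergodic k \<in> C"
  unfolding ergodic_eq_sum using assms by (intro convex_sum) auto

text \<open>
  The energy inequality telescopes to a bound on the sum of the gaps; convexity of the gap turns it
  into the \<open>O(1/k)\<close> estimate for the averages.
\<close>
lemma gap_ergodic_le:
  assumes p: "p \<in> X \<times> Y"
  shows "gap p (ergodic k) \<le> energy 0 p / (real k + 1)"
proof -
  have "(\<Sum>i=1..n. gap p (z i)) + energy n p \<le> energy 0 p" for n
  proof (induction n)
    case (Suc n)
    have "0 \<le> \<delta> * (norm (z (Suc n) - z n))\<^sup>2" using \<delta>(1) by simp
    then show ?case using Suc energy_decrease[OF p, of n] by simp
  qed simp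
  from this[of "k + 1"] have tot: "(\<Sum>i=1..k+1. gap p (z i)) \<le> energy 0 p"
    using energy_nonneg[of "k + 1" p] by linarith
  have "gap p (ergodic k) \<le> (\<Sum>i=1..k+1. 1 / (real k + 1) * gap p (z i))"
    unfolding ergodic_eq_sum using z_in by (intro convex_on_sum[OF _ _ convex_gap]) auto
  also have "\<dots> = (\<Sum>i=1..k+1. gap p (z i)) / (real k + 1)"
    by (simp only: sum_divide_distrib times_divide_eq_left mult_1_left)
  also have "\<dots> \<le> energy 0 p / (real k + 1)" using tot by (intro divide_right_mono) auto
  finally show ?thesis .
qed

text \<open>
  For \<open>c > 0\<close> the averages eventually lie in the sublevel set of \<open>gap p\<close> at level \<open>c\<close>, which is closed and
  convex and therefore contains their weak cluster points.
\<close>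
lemma weak_cluster_point_ergodic_is_saddle:
  assumes "weak_seq_cluster_point ergodic q"
  shows "is_saddle q"
proof -
  obtain r where r: "strict_mono r" "weakly_tendsto (ergodic \<circ> r) q"
    using assms by (auto simp: weak_seq_cluster_point_def)
  have cXY: "convex (X \<times> Y)" using X Y by (auto simp: convex_on_def intro: convex_Times)
  have inXY: "ergodic k \<in> X \<times> Y" for k by (rule ergodic_in_convex[OF cXY z_in])
  have "q \<in> X \<times> Y"
    by (rule closed_convex_weakly_sequentially_closed[OF _ cXY _ r(2)])
      (use X Y inXY in \<open>auto intro: closed_Times\<close>)
  moreover have "gap p q \<le> 0" if p: "p \<in> X \<times> Y" for p
  proof (rule field_le_epsilon)
    fix c :: real assume c: "c > 0"
    have lim: "(\<lambda>k. energy 0 p / (real k + 1)) \<longlonglongrightarrow> 0"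
      using LIMSEQ_Suc[OF lim_const_over_n[of "energy 0 p"]] by (simp add: add.commute)
    have "(\<lambda>k. energy 0 p / (real (r k) + 1)) \<longlonglongrightarrow> 0"
      using LIMSEQ_subseq_LIMSEQ[OF _ r(1), of "\<lambda>k. energy 0 p / (real k + 1)" 0]
      lim by (simp add: o_def)
    then have "eventually (\<lambda>k. energy 0 p / (real (r k) + 1) < c) sequentially"
      using c by (rule order_tendstoD(2))
    then have "eventually (\<lambda>k. (ergodic \<circ> r) k \<in> {q \<in> X \<times> Y. gap p q \<le> c}) sequentially"
    proof eventually_elim
      case (elim k)
      then show ?case using gap_ergodic_le[OF p, of "r k"] inXY[of "r k"] by simp
    qed
    then have "q \<in> {q \<in> X \<times> Y. gap p q \<le> c}"
      using closed_sublevels_gap convex_sublevel[OF convex_gap] r(2)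
      by (intro closed_convex_weakly_sequentially_closed) (auto simp: closed_sublevels_def)
    then show "gap p q \<le> 0 + c" by simp
  qed
  ultimately show ?thesis by (simp add: is_saddle_def)
qed

context
  fixes s assumes s: "is_saddle s"
begin

text \<open>
  Seen from a saddle point the gap is nonnegative and can be dropped.
\<close>
lemma energy_saddle_decrease: "energy (Suc k) s + \<delta> * (norm (z (Suc k) - z k))\<^sup>2 \<le> energy k s"
proof -
  have "0 \<le> gap s (z (Suc k))"
    using s z_in[of "Suc k"] saddle_gap_antisym[of K g h s "z (Suc k)"] by (simp add: is_saddle_def)
  then show ?thesis using energy_decrease[of s k] s by (simp add: is_saddle_def)
qed

lemma decseq_energy_saddle: "decseq (\<lambda>k. energy k s)"
proof (rule decseq_SucI)
  fix k
  have "0 \<le> \<delta> * (norm (z (Suc k) - z k))\<^sup>2" using \<delta>(1) by simp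
  then show "energy (Suc k) s \<le> energy k s" using energy_saddle_decrease[of k] by linarith
qed

lemma iterates_in_cball: "z k \<in> cball s (sqrt (energy 0 s / \<delta>))"
proof -
  have "\<delta> * (norm (z k - s))\<^sup>2 \<le> energy 0 s"
    using energy_lower_bound[of k s] decseqD[OF decseq_energy_saddle, of 0 k] by linarith
  then have "(norm (z k - s))\<^sup>2 \<le> energy 0 s / \<delta>" using \<delta>(1) by (simp add: field_simps)
  then show ?thesis by (simp add: dist_norm norm_minus_commute real_le_rsqrt)
qed

lemma weak_cluster_point_ergodic_exists: "\<exists>q. weak_seq_cluster_point ergodic q"
proof -
  have "ergodic k \<in> cball s (sqrt (energy 0 s / \<delta>))" for k
    by (intro ergodic_in_convex iterates_in_cball convex_cball)
  then have "range ergodic \<subseteq> cball s (sqrt (energy 0 s / \<delta>))" by (intro image_subsetI)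
  then have "bounded (range ergodic)" by (rule bounded_subset[OF bounded_cball])
  then obtain r q where "strict_mono r" "weakly_tendsto (ergodic \<circ> r) q"
    by (rule bounded_imp_weakly_convergent_subsequence)
  then show ?thesis unfolding weak_seq_cluster_point_def by blast
qed

lemma steps_tendsto_0: "(\<lambda>k. z (Suc k) - z k) \<longlonglongrightarrow> 0"
proof -
  have "convergent (\<lambda>k. energy k s)"
    using decseq_energy_saddle energy_nonneg by (intro nonneg_decseq_convergent)
  then obtain l where l: "(\<lambda>k. energy k s) \<longlonglongrightarrow> l" by (auto simp: convergent_def)
  show ?thesis
  proof (rule tendsto_zero_if_norm_square_le[OF \<delta>(1)])
    show "\<delta> * (norm (z (Suc k) - z k))\<^sup>2 \<le> energy k s - energy (Suc k) s" for k
      using energy_saddle_decrease[of k] by linarith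
    show "(\<lambda>k. energy k s - energy (Suc k) s) \<longlonglongrightarrow> 0"
      using tendsto_diff[OF l LIMSEQ_Suc[OF l]] by simp
  qed
qed

end

lemma weights_convergent: "convergent a" "convergent b"
proof -
  have "a (Suc k) \<le> a k" "b (Suc k) \<le> b k" for k
    using L(1) a_step[of k] b_step[of k] mult_nonneg_nonneg[OF L(1) zero_le_power2]
    by (metis diff_ge_0_iff_ge)+
  moreover have "0 \<le> a k" "0 \<le> b k" for k using \<delta>(1) \<delta>(2,3)[of k] L(1) by auto
  ultimately show "convergent a" "convergent b"
    by (auto intro!: nonneg_decseq_convergent decseq_SucI)
qed

text \<open>
  The weights are monotone and bounded, so the energy converges along every strongly convergent
  subsequence on which the last primal step tends to \<open>0\<close>, and the limit depends only on the limit
  point. It is therefore the same along the subsequence shifted by one.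
\<close>
lemma energy_tendsto:
  assumes r: "strict_mono r" and q: "(\<lambda>n. z (r n)) \<longlonglongrightarrow> q"
    and st: "(\<lambda>n. x (r n) - x (r n - 1)) \<longlonglongrightarrow> 0"
  shows "(\<lambda>n. energy (r n) p) \<longlonglongrightarrow>
    lim a / 2 * (norm (fst q - fst p))\<^sup>2 + lim b / 2 * (norm (snd q - snd p))\<^sup>2"
proof -
  have ab: "(\<lambda>n. a (r n)) \<longlonglongrightarrow> lim a" "(\<lambda>n. b (r n)) \<longlonglongrightarrow> lim b"
    using weights_convergent r LIMSEQ_subseq_LIMSEQ[OF _ r] by (auto simp: convergent_LIMSEQ_iff o_def)
  have xy: "(\<lambda>n. x (r n)) \<longlonglongrightarrow> fst q" "(\<lambda>n. y (r n)) \<longlonglongrightarrow> snd q"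
    using tendsto_fst[OF q] tendsto_snd[OF q] by simp_all
  have "(\<lambda>n. energy (r n) p) \<longlonglongrightarrow>
    lim a / 2 * (norm (fst q - fst p))\<^sup>2 + lim b / 2 * (norm (snd q - snd p))\<^sup>2
    + K 0 \<bullet> (snd q - snd p) + L * (norm (0::'a))\<^sup>2"
    unfolding energy_def
    by (intro tendsto_intros ab xy st bounded_linear.tendsto[OF K]) auto
  then show ?thesis by (simp add: linear_0 bounded_linear.linear[OF K])
qed

text \<open>
  The gap at \<open>z (Suc (r n))\<close> is at most the decrease of the energy from \<open>r n\<close> to \<open>Suc (r n)\<close>. Both energies
  have the same limit, because the steps tend to \<open>0\<close>; so the gap at the cluster point is nonpositive.
\<close>
lemma cluster_point_is_saddle:
  assumes s: "is_saddle s" and r: "strict_mono r" and q: "(\<lambda>n. z (r n)) \<longlonglongrightarrow> q"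
  shows "is_saddle q" "(\<lambda>n. energy (r n) q) \<longlonglongrightarrow> 0"
proof -
  have Sr: "strict_mono (\<lambda>n. Suc (r n))" using r by (auto simp: strict_mono_def)
  have "(\<lambda>n. x (Suc n) - x n) \<longlonglongrightarrow> 0"
    using tendsto_fst[OF steps_tendsto_0[OF s]] by simp
  then have st: "(\<lambda>n. x n - x (n - 1)) \<longlonglongrightarrow> 0" by (subst filterlim_sequentially_Suc[symmetric]) simp
  have st1: "(\<lambda>n. x (r n) - x (r n - 1)) \<longlonglongrightarrow> 0"
    using LIMSEQ_subseq_LIMSEQ[OF st r] by (simp add: o_def)
  have st2: "(\<lambda>n. x (Suc (r n)) - x (Suc (r n) - 1)) \<longlonglongrightarrow> 0"
    using LIMSEQ_subseq_LIMSEQ[OF st Sr] by (simp add: o_def)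
  have "(\<lambda>n. z (r n) + (z (Suc (r n)) - z (r n))) \<longlonglongrightarrow> q + 0"
    using LIMSEQ_subseq_LIMSEQ[OF steps_tendsto_0[OF s] r] by (intro tendsto_add q) (simp add: o_def)
  then have q': "(\<lambda>n. z (Suc (r n))) \<longlonglongrightarrow> q" by simp
  have XY: "closed (X \<times> Y)" using X Y by (simp add: closed_Times)
  have "q \<in> X \<times> Y" using closed_sequentially[OF XY _ q] z_in by blast
  moreover have "gap p q \<le> 0" if p: "p \<in> X \<times> Y" for p
  proof (rule field_le_epsilon)
    fix c :: real assume c: "c > 0"
    have "(\<lambda>n. energy (r n) p - energy (Suc (r n)) p) \<longlonglongrightarrow> 0"
      using tendsto_diff[OF energy_tendsto[OF r q st1, of p] energy_tendsto[OF Sr q' st2, of p]] by simp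
    then have "eventually (\<lambda>n. energy (r n) p - energy (Suc (r n)) p < c) sequentially"
      using c by (rule order_tendstoD(2))
    then have ev: "eventually (\<lambda>n. z (Suc (r n)) \<in> {q \<in> X \<times> Y. gap p q \<le> c}) sequentially"
    proof eventually_elim
      case (elim n)
      have "0 \<le> \<delta> * (norm (z (Suc (r n)) - z (r n)))\<^sup>2" using \<delta>(1) by simp
      then show ?case using elim energy_decrease[OF p, of "r n"] z_in[of "Suc (r n)"] by auto
    qed
    have "closed {q \<in> X \<times> Y. gap p q \<le> c}" using closed_sublevels_gap by (simp add: closed_sublevels_def)
    then have "q \<in> {q \<in> X \<times> Y. gap p q \<le> c}"
      using Lim_in_closed_set[OF _ ev _ q'] by simp
    then show "gap p q \<le> 0 + c" by simp
  qed
  ultimately show "is_saddle q" by (simp add: is_saddle_def)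
  show "(\<lambda>n. energy (r n) q) \<longlonglongrightarrow> 0"
    using energy_tendsto[OF r q st1, of q] by simp
qed

text \<open>
  A cluster point \<open>q\<close> of the iterates exists by compactness and is a saddle point, so the energy relative
  to \<open>q\<close> is monotone. Along the subsequence it tends to \<open>0\<close>, hence it tends to \<open>0\<close> altogether, and it
  dominates \<open>\<delta>\<close> times the squared distance to \<open>q\<close>.
\<close>
lemma tendsto_saddle_finite_dimensional:
  assumes s: "is_saddle s"
    and fa: "\<exists>B::'a set. finite_dimensional_vector_space scaleR B"
    and fb: "\<exists>B::'b set. finite_dimensional_vector_space scaleR B"
  shows "\<exists>q. is_saddle q \<and> z \<longlonglongrightarrow> q"
proof -
  have "range z \<subseteq> cball s (sqrt (energy 0 s / \<delta>))"
    using iterates_in_cball[OF s] by (intro image_subsetI)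
  then have "bounded (range z)" by (rule bounded_subset[OF bounded_cball])
  then obtain r q where r: "strict_mono r" and w: "weakly_tendsto (z \<circ> r) q"
    by (rule bounded_imp_weakly_convergent_subsequence)
  have "weakly_tendsto (x \<circ> r) (fst q)" "weakly_tendsto (y \<circ> r) (snd q)"
    using w unfolding weakly_tendsto_def o_def
    by (auto dest: bounded_linear_compose[OF _ bounded_linear_fst] bounded_linear_compose[OF _ bounded_linear_snd])
  then have "(x \<circ> r) \<longlonglongrightarrow> fst q" "(y \<circ> r) \<longlonglongrightarrow> snd q"
    using fa fb by (auto intro: finite_dimensional_weakly_tendsto_imp_tendsto)
  then have q: "(\<lambda>n. z (r n)) \<longlonglongrightarrow> q" using tendsto_Pair by (fastforce simp: o_def)
  note sq = cluster_point_is_saddle[OF s r q]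
  have "(\<lambda>k. energy k q) \<longlonglongrightarrow> 0"
  proof -
    have "convergent (\<lambda>k. energy k q)"
      using decseq_energy_saddle[OF sq(1)] energy_nonneg by (intro nonneg_decseq_convergent)
    then obtain l where l: "(\<lambda>k. energy k q) \<longlonglongrightarrow> l" by (auto simp: convergent_def)
    have "l = 0" using LIMSEQ_subseq_LIMSEQ[OF l r] sq(2) by (auto simp: o_def intro: LIMSEQ_unique)
    then show ?thesis using l by simp
  qed
  then have "(\<lambda>k. z k - q) \<longlonglongrightarrow> 0"
    by (rule tendsto_zero_if_norm_square_le[OF \<delta>(1) energy_lower_bound])
  then have "z \<longlonglongrightarrow> q" by (simp add: LIM_zero_iff)
  then show ?thesis using sq(1) by blast
qed

end

section \<open>Extended-valued data and step sizes\<close>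

lemma saddle_fun_proper_imp_finite:
  assumes ne: "X \<noteq> {}" "Y \<noteq> {}"
    and g: "proper_on UNIV g" and h: "proper_on UNIV h"
    and px: "\<forall>v\<in>Y. proper_on X (\<lambda>u. saddle_fun K g h u v)"
    and py: "\<forall>u\<in>X. proper_on Y (\<lambda>v. - saddle_fun K g h u v)"
  shows "u \<in> X \<Longrightarrow> g u = ereal (real_of_ereal (g u))"
    and "v \<in> Y \<Longrightarrow> h v = ereal (real_of_ereal (h v))"
proof -
  have gm: "g u \<noteq> -\<infinity>" and hm: "h v \<noteq> -\<infinity>" for u v using g h by (auto simp: proper_on_def)
  have gp: "g u \<noteq> \<infinity>" if "u \<in> X" for u
  proof
    assume inf: "g u = \<infinity>"
    obtain v where v: "v \<in> Y" using ne by blast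
    have "saddle_fun K g h u v = \<infinity>" using hm[of v] inf by (cases "h v") (auto simp: saddle_fun_def)
    then show False using py that v by (auto simp: proper_on_def)
  qed
  have hp: "h v \<noteq> \<infinity>" if "v \<in> Y" for v
  proof
    assume inf: "h v = \<infinity>"
    obtain u where u: "u \<in> X" using ne by blast
    have "saddle_fun K g h u v = -\<infinity>" using gm[of u] gp[OF u] inf by (cases "g u") (auto simp: saddle_fun_def)
    then show False using px that u by (auto simp: proper_on_def)
  qed
  show "u \<in> X \<Longrightarrow> g u = ereal (real_of_ereal (g u))" using gm[of u] gp[of u] by (cases "g u") auto
  show "v \<in> Y \<Longrightarrow> h v = ereal (real_of_ereal (h v))" using hm[of v] hp[of v] by (cases "h v") auto
qed

lemma saddle_point_iff_gap_nonpos: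
  assumes g: "\<forall>u\<in>X. g u = ereal (g' u)" and h: "\<forall>v\<in>Y. h v = ereal (h' v)"
  shows "saddle_point X Y (saddle_fun K g h) q \<longleftrightarrow>
    q \<in> X \<times> Y \<and> (\<forall>p\<in>X \<times> Y. saddle_gap K g' h' p q \<le> 0)"
proof -
  have f: "saddle_fun K g h u v = ereal (K u \<bullet> v + g' u - h' v)" if "u \<in> X" "v \<in> Y" for u v
    using that g h by (simp add: saddle_fun_def)
  show ?thesis
  proof (cases "q \<in> X \<times> Y")
    case True
    then obtain a b where q: "q = (a, b)" "a \<in> X" "b \<in> Y" by auto
    show ?thesis
    proof
      assume sp: "saddle_point X Y (saddle_fun K g h) q"
      have "saddle_gap K g' h' (u, v) q \<le> 0" if "u \<in> X" "v \<in> Y" for u v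
        using sp that q f by (fastforce simp: saddle_point_def saddle_gap_def)
      then show "q \<in> X \<times> Y \<and> (\<forall>p\<in>X \<times> Y. saddle_gap K g' h' p q \<le> 0)" using True by auto
    next
      assume "q \<in> X \<times> Y \<and> (\<forall>p\<in>X \<times> Y. saddle_gap K g' h' p q \<le> 0)"
      then have gap: "saddle_gap K g' h' (u, v) q \<le> 0" if "u \<in> X" "v \<in> Y" for u v using that by auto
      show "saddle_point X Y (saddle_fun K g h) q"
        unfolding saddle_point_def
      proof (intro conjI ballI)
        show "q \<in> X \<times> Y" by fact
        fix u v assume uv: "u \<in> X" "v \<in> Y"
        show "saddle_fun K g h (fst q) v \<le> saddle_fun K g h (fst q) (snd q)"
          using gap[OF q(2) uv(2)] uv q by (simp add: f saddle_gap_def)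
        show "saddle_fun K g h (fst q) (snd q) \<le> saddle_fun K g h u (snd q)"
          using gap[OF uv(1) q(3)] uv q by (simp add: f saddle_gap_def)
      qed
    qed
  qed (simp add: saddle_point_def)
qed

text \<open>
  The step-size rule makes \<open>\<tau>\<close> nondecreasing, so its upper limit \<open>T\<close> bounds every \<open>\<tau> k\<close>; the uniform margin is
  \<open>\<delta> = 1 / (2 T) - L\<close>, positive because \<open>L T < 1/2\<close>.
\<close>
lemma inverse_step_sizes_bounded_below:
  fixes \<tau> c :: "nat \<Rightarrow> real"
  assumes pos: "\<forall>k. \<tau> k > 0" and L: "0 \<le> L"
    and step: "\<forall>i. L * (c i)\<^sup>2 = 1 / \<tau> i - 1 / \<tau> (Suc i)"
    and fin: "limsup (\<lambda>i. ereal (\<tau> i)) < \<infinity>"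
    and half: "ereal L * limsup (\<lambda>i. ereal (\<tau> i)) < ereal (1/2)"
  obtains \<delta> where "\<delta> > 0" "\<And>k. L + \<delta> \<le> 1 / \<tau> k / 2"
proof -
  have "\<tau> i \<le> \<tau> (Suc i)" for i
  proof -
    have "0 \<le> 1 / \<tau> i - 1 / \<tau> (Suc i)" using step[rule_format, of i] L by (metis mult_nonneg_nonneg zero_le_power2)
    then show ?thesis using pos[rule_format, of i] pos[rule_format, of "Suc i"] by (simp add: field_simps)
  qed
  then have mono: "\<tau> i \<le> \<tau> j" if "i \<le> j" for i j using that by (rule lift_Suc_mono_le)
  have le: "ereal (\<tau> i) \<le> limsup (\<lambda>i. ereal (\<tau> i))" for i
    by (intro le_Limsup) (auto intro!: eventually_sequentiallyI[of i] mono)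
  then obtain T where T: "limsup (\<lambda>i. ereal (\<tau> i)) = ereal T"
    using fin le[of 0] by (cases "limsup (\<lambda>i. ereal (\<tau> i))") auto
  have \<tau>T: "\<tau> i \<le> T" for i using le[of i] by (simp add: T)
  have T0: "T > 0" using \<tau>T[of 0] pos by (metis less_le_trans)
  have "L * T < 1/2" using half by (simp add: T)
  then have "1 / T / 2 - L > 0" using T0 by (simp add: field_simps)
  moreover have "L + (1 / T / 2 - L) \<le> 1 / \<tau> k / 2" for k
  proof -
    have "1 / T \<le> 1 / \<tau> k" using \<tau>T[of k] pos by (intro frac_le) auto
    from divide_right_mono[OF this, of 2] show ?thesis by linarith
  qed
  ultimately show ?thesis using that by blast
qed

section \<open>Convergence of the iteration\<close>

theorem theorem4p2:
  fixes X :: "'a::{real_inner, complete_space} set"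
    and Y :: "'b::{real_inner, complete_space} set"
    and K :: "'a \<Rightarrow> 'b"
    and g :: "'a \<Rightarrow> ereal" and h :: "'b \<Rightarrow> ereal"
    and \<tau> \<sigma> :: "nat \<Rightarrow> real"
    and \<alpha> \<beta> :: "int \<Rightarrow> real"
    and x xbar xhat :: "nat \<Rightarrow> 'a" and y ybar yhat :: "nat \<Rightarrow> 'b"
    and xs :: 'a and ys :: 'b
    and f :: "'a \<Rightarrow> 'b \<Rightarrow> ereal"
  defines "f \<equiv> saddle_fun K g h"
    and "xhat \<equiv> (\<lambda>k. (1 / (real k + 1)) *\<^sub>R (\<Sum>i=1..k+1. x i))"
    and "yhat \<equiv> (\<lambda>k. (1 / (real k + 1)) *\<^sub>R (\<Sum>i=1..k+1. y i))"
  assumes "X \<noteq> {}" "closed X" "convex X"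
    and "Y \<noteq> {}" "closed Y" "convex Y"
    and "bounded_linear K"
    and "proper_on UNIV g" "convex_ereal_fun g" "lsc_fun g"
    and "proper_on UNIV h" "convex_ereal_fun h" "lsc_fun h"
    and "\<forall>v\<in>Y. proper_on X (\<lambda>u. f u v)"
    and "\<forall>u\<in>X. proper_on Y (\<lambda>v. - f u v)"
    and "\<forall>k. \<tau> k > 0" "\<forall>k. \<sigma> k > 0"
    and "\<forall>k\<ge>-1. \<alpha> k \<ge> 0" "\<forall>k\<ge>-1. \<beta> k \<ge> 0"
    and "x 0 \<in> X" "y 0 \<in> Y" "xbar 0 = x 0" "ybar 0 = y 0"
    and "\<forall>k. y (Suc k) = prox Y (\<lambda>v. ereal (\<sigma> k) * h v) (y k + \<sigma> k *\<^sub>R K (xbar k))"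
    and "\<forall>k. ybar (Suc k) = y (Suc k) + \<beta> (int k) *\<^sub>R (y (Suc k) - y k)"
    and "\<forall>k. x (Suc k) = prox X (\<lambda>u. ereal (\<tau> k) * g u) (x k - \<tau> k *\<^sub>R adjoint K (ybar (Suc k)))"
    and "\<forall>k. xbar (Suc k) = x (Suc k) + \<alpha> (int k) *\<^sub>R (x (Suc k) - x k)"
    and "saddle_point X Y f (xs, ys)"
    and "\<forall>i. onorm K * (\<beta> (int i))\<^sup>2 = 1 / \<tau> i - 1 / \<tau> (Suc i)"
    and "\<forall>i. onorm K * (1 - \<alpha> (int i - 1))\<^sup>2 = 1 / \<sigma> i - 1 / \<sigma> (Suc i)"
    and "limsup (\<lambda>i. ereal (\<tau> i)) < \<infinity>" "limsup (\<lambda>i. ereal (\<sigma> i)) < \<infinity>"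
    and "ereal (onorm K) * limsup (\<lambda>i. ereal (\<tau> i)) < ereal (1/2)"
    and "ereal (onorm K) * limsup (\<lambda>i. ereal (\<sigma> i)) < ereal (1/2)"
  shows "((\<exists>p. weak_seq_cluster_point (\<lambda>k. (xhat k, yhat k)) p) \<and>
          (\<forall>p. weak_seq_cluster_point (\<lambda>k. (xhat k, yhat k)) p \<longrightarrow> saddle_point X Y f p)) \<and>
         ((\<exists>B::'a set. finite_dimensional_vector_space scaleR B) \<and>
          (\<exists>B::'b set. finite_dimensional_vector_space scaleR B) \<and>
          (SUP k::nat. ereal (\<alpha> (int k))) < \<infinity> \<and>
          (SUP k::nat. ereal (\<beta> (int k))) < \<infinity> \<and>
          0 < (INF k. ereal (\<sigma> k)) \<and> (SUP k. ereal (\<sigma> k)) < \<infinity> \<and>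
          0 < (INF k. ereal (\<tau> k)) \<and> (SUP k. ereal (\<tau> k)) < \<infinity>
          \<longrightarrow> (\<exists>p. saddle_point X Y f p \<and> (\<lambda>k. (x k, y k)) \<longlonglongrightarrow> p))"
proof -
  define g' where "g' u = real_of_ereal (g u)" for u
  define h' where "h' v = real_of_ereal (h v)" for v
  let ?L = "onorm K"
  interpret K: bounded_linear K by (rule \<open>bounded_linear K\<close>)
  note standing = \<open>\<forall>v\<in>Y. proper_on X (\<lambda>u. f u v)\<close>[unfolded f_def]
    \<open>\<forall>u\<in>X. proper_on Y (\<lambda>v. - f u v)\<close>[unfolded f_def]
  have g': "\<And>u. u \<in> X \<Longrightarrow> g u = ereal (g' u)" and h': "\<And>v. v \<in> Y \<Longrightarrow> h v = ereal (h' v)"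
    using saddle_fun_proper_imp_finite[OF \<open>X \<noteq> {}\<close> \<open>Y \<noteq> {}\<close> \<open>proper_on UNIV g\<close> \<open>proper_on UNIV h\<close> standing]
    by (simp_all add: g'_def h'_def)
  have gX: "convex_on X g'" "closed_sublevels X g'"
    using convex_ereal_fun_imp_convex_on[OF \<open>convex_ereal_fun g\<close> \<open>convex X\<close> g']
      lsc_fun_imp_closed_sublevels[OF \<open>lsc_fun g\<close> \<open>closed X\<close> g'] by auto
  have hY: "convex_on Y h'" "closed_sublevels Y h'"
    using convex_ereal_fun_imp_convex_on[OF \<open>convex_ereal_fun h\<close> \<open>convex Y\<close> h']
      lsc_fun_imp_closed_sublevels[OF \<open>lsc_fun h\<close> \<open>closed Y\<close> h'] by auto
  have fin: "\<forall>u\<in>X. g u = ereal (g' u)" "\<forall>v\<in>Y. h v = ereal (h' v)" using g' h' by blast+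
  note proxX = prox_in_and_variational_inequality[OF \<open>X \<noteq> {}\<close> \<open>closed X\<close> gX fin(1)]
  note proxY = prox_in_and_variational_inequality[OF \<open>Y \<noteq> {}\<close> \<open>closed Y\<close> hY fin(2)]
  note \<tau> = \<open>\<forall>k. \<tau> k > 0\<close>[rule_format] and \<sigma> = \<open>\<forall>k. \<sigma> k > 0\<close>[rule_format]
  note xeq = \<open>\<forall>k. x (Suc k) = _ k\<close>[rule_format] and yeq = \<open>\<forall>k. y (Suc k) = _ k\<close>[rule_format]
  note xbar_eq = \<open>\<forall>k. xbar (Suc k) = _ k\<close>[rule_format] and ybar_eq = \<open>\<forall>k. ybar (Suc k) = _ k\<close>[rule_format]
  have L0: "0 \<le> ?L" by (rule onorm_pos_le) (rule \<open>bounded_linear K\<close>)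
  obtain \<delta>1 where \<delta>1: "\<delta>1 > 0" "\<And>k. ?L + \<delta>1 \<le> 1 / \<tau> k / 2"
    using inverse_step_sizes_bounded_below[OF \<open>\<forall>k. \<tau> k > 0\<close> L0
      \<open>\<forall>i. onorm K * (\<beta> (int i))\<^sup>2 = _ i\<close> \<open>limsup (\<lambda>i. ereal (\<tau> i)) < \<infinity>\<close>
      \<open>ereal (onorm K) * limsup (\<lambda>i. ereal (\<tau> i)) < ereal (1/2)\<close>] by metis
  obtain \<delta>2 where \<delta>2: "\<delta>2 > 0" "\<And>k. ?L + \<delta>2 \<le> 1 / \<sigma> k / 2"
    using inverse_step_sizes_bounded_below[OF \<open>\<forall>k. \<sigma> k > 0\<close> L0
      \<open>\<forall>i. onorm K * (1 - \<alpha> (int i - 1))\<^sup>2 = _ i\<close> \<open>limsup (\<lambda>i. ereal (\<sigma> i)) < \<infinity>\<close>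
      \<open>ereal (onorm K) * limsup (\<lambda>i. ereal (\<sigma> i)) < ereal (1/2)\<close>] by metis
  interpret P: primal_dual_iteration X Y K g' h' ?L "min \<delta>1 \<delta>2" "\<lambda>k. 1 / \<tau> k" "\<lambda>k. 1 / \<sigma> k"
    "\<lambda>k. \<beta> (int k)" "\<lambda>k. 1 - \<alpha> (int k - 1)" x y
  proof
    show "K u \<bullet> v \<le> ?L * (norm u * norm v)" for u v
    proof -
      have "K u \<bullet> v \<le> norm (K u) * norm v" by (rule norm_cauchy_schwarz)
      also have "\<dots> \<le> (?L * norm u) * norm v"
        by (intro mult_right_mono onorm K.bounded_linear_axioms) auto
      finally show ?thesis by (simp add: mult.assoc)
    qed
    show "x k \<in> X" for k using proxX(1) \<tau> \<open>x 0 \<in> X\<close> xeq by (cases k) auto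
    show "y k \<in> Y" for k using proxY(1) \<sigma> \<open>y 0 \<in> Y\<close> yeq by (cases k) auto
    show "h' (y (Suc k)) - h' v \<le> ((1 / \<sigma> k) *\<^sub>R (y k - y (Suc k))
        + K (x k + (1 - (1 - \<alpha> (int k - 1))) *\<^sub>R (x k - x (k - 1)))) \<bullet> (y (Suc k) - v)"
      if v: "v \<in> Y" for k v
    proof -
      have "xbar k = x k + (1 - (1 - \<alpha> (int k - 1))) *\<^sub>R (x k - x (k - 1))"
        using \<open>xbar 0 = x 0\<close> xbar_eq by (cases k) auto
      moreover have "(1 / \<sigma> k) *\<^sub>R (y k + \<sigma> k *\<^sub>R K (xbar k) - y (Suc k))
          = (1 / \<sigma> k) *\<^sub>R (y k - y (Suc k)) + K (xbar k)"
        using \<sigma>[of k] by (simp add: scaleR_diff_right scaleR_add_right)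
      ultimately show ?thesis
        using proxY(2)[OF \<sigma>[of k] v, where v = "y k + \<sigma> k *\<^sub>R K (xbar k)"] unfolding yeq[symmetric]
        by metis
    qed
    show "g' (x (Suc k)) - g' u \<le> 1 / \<tau> k * ((x k - x (Suc k)) \<bullet> (x (Suc k) - u))
        - K (x (Suc k) - u) \<bullet> (y (Suc k) + \<beta> (int k) *\<^sub>R (y (Suc k) - y k))"
      if u: "u \<in> X" for k u
    proof -
      have "(1 / \<tau> k) *\<^sub>R (x k - \<tau> k *\<^sub>R adjoint K (ybar (Suc k)) - x (Suc k))
          = (1 / \<tau> k) *\<^sub>R (x k - x (Suc k)) - adjoint K (ybar (Suc k))"
        using \<tau>[of k] by (simp add: scaleR_diff_right)
      then have "g' (x (Suc k)) - g' u
          \<le> ((1 / \<tau> k) *\<^sub>R (x k - x (Suc k)) - adjoint K (ybar (Suc k))) \<bullet> (x (Suc k) - u)"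
        using proxX(2)[OF \<tau>[of k] u, where v = "x k - \<tau> k *\<^sub>R adjoint K (ybar (Suc k))"]
        unfolding xeq[symmetric] by metis
      also have "\<dots> = 1 / \<tau> k * ((x k - x (Suc k)) \<bullet> (x (Suc k) - u)) - K (x (Suc k) - u) \<bullet> ybar (Suc k)"
        unfolding inner_adjoint[OF \<open>bounded_linear K\<close>]
        by (simp add: inner_diff_left[of "_ *\<^sub>R _"] inner_commute[of "adjoint K _"])
      finally show ?thesis unfolding ybar_eq .
    qed
    show "?L + min \<delta>1 \<delta>2 \<le> 1 / \<tau> k / 2" "?L + min \<delta>1 \<delta>2 \<le> 1 / \<sigma> k / 2" for k
      using \<delta>1(2)[of k] \<delta>2(2)[of k] by linarith+
  qed (use K.bounded_linear_axioms L0 \<delta>1(1) \<delta>2(1) \<open>closed X\<close> \<open>closed Y\<close> gX hY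
      \<open>\<forall>i. onorm K * (\<beta> (int i))\<^sup>2 = _ i\<close> \<open>\<forall>i. onorm K * (1 - \<alpha> (int i - 1))\<^sup>2 = _ i\<close> in auto)
  have saddle_iff: "P.is_saddle q \<longleftrightarrow> saddle_point X Y f q" for q
    unfolding f_def P.is_saddle_def saddle_point_iff_gap_nonpos[OF fin] ..
  have s: "P.is_saddle (xs, ys)" using \<open>saddle_point X Y f (xs, ys)\<close> by (simp add: saddle_iff)
  have avg: "(\<lambda>k. (xhat k, yhat k)) = P.ergodic"
    by (rule ext) (simp add: prod_eq_iff P.ergodic_def xhat_def yhat_def fst_sum snd_sum)
  show ?thesis
    unfolding avg saddle_iff[symmetric]
    using P.weak_cluster_point_ergodic_exists[OF s] P.weak_cluster_point_ergodic_is_saddle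
      P.tendsto_saddle_finite_dimensional[OF s] by blast
qed

end
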